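(* Let $H:\mathbb{R}^d\times\mathbb{R}^d\to\mathbb{R}$ be a smooth Hamiltonian, let $\lambda\in\mathbb{R}$ with $\lambda\neq\frac12$, and let $r\ge1$ be an integer. Let $K_i(u,v)$, $i\ge1$, be the coefficient functions obtained by inserting the power series $S(u,v,t)=\sum_{i\ge1}K_i(u,v)t^i$ into $$\frac{\partial S}{\partial t}(u,v,t)=H\left(u-(1-\lambda)\frac{\partial S}{\partial v}(u,v,t),\ v+\lambda\frac{\partial S}{\partial u}(u,v,t)\right)$$ and comparing like powers of $t$, and put $\bar S(u,v)=\sum_{i=1}^rK_i(u,v)h^i$. Then the one-step scheme $(p_n,q_n)\mapsto(p_{n+1},q_{n+1})$ defined by $$p_{n+1}=p_n-\partial_v\bar S(\bar u,\bar v),\qquad q_{n+1}=q_n+\partial_u\bar S(\bar u,\bar v),\qquad \bar u=\lambda p_{n+1}+(1-\lambda)p_n,\quad \bar v=\lambda q_n+(1-\lambda)q_{n+1},$$ is a symplectic scheme of order $r$ for the Hamiltonian system $\dot p=-H_q(p,q)$, $\dot q=H_p(p,q)$.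
   Context: $H_p,H_q$ denote the column vectors of partial derivatives of $H=H(p,q)$ with respect to its first and second argument; $u,v\in\mathbb{R}^d$, and $\partial_u,\partial_v$ denote gradients. The coefficients $K_i$ are uniquely determined recursively as formal power series coefficients; e.g. $K_1=H$ and $K_2=(\lambda-\frac12)(\partial_uH)^T\partial_vH$. The step size $h$ is small enough that the implicit equations locally define a smooth map close to the identity. A one-step scheme is symplectic if $M=\partial(p_{n+1},q_{n+1})/\partial(p_n,q_n)$ satisfies $M^TJM=J$ with $J=\begin{pmatrix}0&I_d\\-I_d&0\end{pmatrix}$. It is of order $r$ if its local error, i.e. the difference after one step of size $h$ between the numerical and the exact solution starting from the same point, is $\mathcal{O}(h^{r+1})$ as $h\to0$. *)

theory Defs
  imports "HOL-Analysis.Analysis" "HOL-Computational_Algebra.Formal_Power_Series"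
    "HOL-Library.Landau_Symbols"
begin

(* $ is vector indexing throughout; fps coefficients are written fps_nth. *)
unbundle no fps_syntax

(* Phase space points and the arguments (u, v) of generating functions are pairs in R^d x R^d,
   where d = CARD('n) is arbitrary. *)
type_synonym 'n phase = "(real ^ 'n) \<times> (real ^ 'n)"


(* Intended for open S, since derivatives at points of S are taken in a full neighbourhood. *)
primrec higher_differentiable_on ::
    "'a::real_normed_vector set \<Rightarrow> ('a \<Rightarrow> 'b::real_normed_vector) \<Rightarrow> nat \<Rightarrow> bool" where
  "higher_differentiable_on S f 0 \<longleftrightarrow> continuous_on S f"
| "higher_differentiable_on S f (Suc k) \<longleftrightarrow>
     (\<forall>x\<in>S. f differentiable (at x)) \<and>
     (\<forall>v. higher_differentiable_on S (\<lambda>x. frechet_derivative f (at x) v) k)"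

definition smooth_on :: "'a::real_normed_vector set \<Rightarrow> ('a \<Rightarrow> 'b::real_normed_vector) \<Rightarrow> bool" where
  "smooth_on S f \<longleftrightarrow> (\<forall>k. higher_differentiable_on S f k)"


definition grad :: "(real ^ 'n \<Rightarrow> real) \<Rightarrow> real ^ 'n \<Rightarrow> real ^ 'n" where
  "grad f x = (\<chi> i. frechet_derivative f (at x) (axis i 1))"

definition grad1 :: "('n::finite phase \<Rightarrow> real) \<Rightarrow> 'n phase \<Rightarrow> real ^ 'n" where
  "grad1 F w = grad (\<lambda>x. F (x, snd w)) (fst w)"

definition grad2 :: "('n::finite phase \<Rightarrow> real) \<Rightarrow> 'n phase \<Rightarrow> real ^ 'n" where
  "grad2 F w = grad (\<lambda>y. F (fst w, y)) (snd w)"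


(* The formal power series F(c 0 + c 1 t + c 2 t^2 + ...) for smooth F, that is, the Taylor series
   of F at c 0 with the formal curve inserted. Its coefficient of t^m involves only c 0, ..., c m;
   it is the m-th Taylor coefficient at t = 0 of F along the curve truncated after t^m. *)
definition formal_comp :: "('a::real_normed_vector \<Rightarrow> real) \<Rightarrow> (nat \<Rightarrow> 'a) \<Rightarrow> real fps" where
  "formal_comp F c =
     Abs_fps (\<lambda>m. (deriv ^^ m) (\<lambda>t. F (\<Sum>j\<le>m. t ^ j *\<^sub>R c j)) 0 / fact m)"

(* K i is the coefficient of t^i in S(u, v, t). The partial derivatives of S with respect to u and v
   are taken coefficientwise, and S has no constant term. *)
definition generating_coeffs :: "('n::finite phase \<Rightarrow> real) \<Rightarrow> real \<Rightarrow> (nat \<Rightarrow> 'n phase \<Rightarrow> real) \<Rightarrow> bool" where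
  "generating_coeffs H lam K \<longleftrightarrow>
     K 0 = (\<lambda>_. 0) \<and>
     (\<forall>u v. fps_deriv (Abs_fps (\<lambda>i. K i (u, v))) =
        formal_comp H (\<lambda>i. if i = 0 then (u, v)
          else (- (1 - lam) *\<^sub>R grad2 (K i) (u, v), lam *\<^sub>R grad1 (K i) (u, v))))"

lemma generating_coeffs_iff:
  "generating_coeffs H lam K \<longleftrightarrow>
     K 0 = (\<lambda>_. 0) \<and>
     (\<forall>m u v. real (Suc m) * K (Suc m) (u, v) =
        fps_nth (formal_comp H (\<lambda>i. if i = 0 then (u, v)
          else (- (1 - lam) *\<^sub>R grad2 (K i) (u, v), lam *\<^sub>R grad1 (K i) (u, v)))) m)"
  by (auto simp: generating_coeffs_def fps_eq_iff)

lemma formal_comp_nth_cong: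
  assumes "\<And>j. j \<le> m \<Longrightarrow> c j = c' j"
  shows "fps_nth (formal_comp F c) m = fps_nth (formal_comp F c') m"
proof -
  have "(\<Sum>j\<le>m. t ^ j *\<^sub>R c j) = (\<Sum>j\<le>m. t ^ j *\<^sub>R c' j)" for t :: real
    using assms by (intro sum.cong) auto
  then show ?thesis by (simp add: formal_comp_def)
qed

lemma generating_coeffs_ex1:
  fixes H :: "'n::finite phase \<Rightarrow> real"
  shows "\<exists>!K. generating_coeffs H lam K"
proof -
  define c where "c = (\<lambda>(K :: nat \<Rightarrow> 'n phase \<Rightarrow> real) w i. if i = 0 then w
    else (- (1 - lam) *\<^sub>R grad2 (K i) w, lam *\<^sub>R grad1 (K i) w))"
  have iff: "generating_coeffs H lam K \<longleftrightarrow> K 0 = (\<lambda>_. 0) \<and>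
     (\<forall>m w. K (Suc m) w = fps_nth (formal_comp H (c K w)) m / real (Suc m))"
    for K :: "nat \<Rightarrow> 'n phase \<Rightarrow> real"
    unfolding generating_coeffs_iff c_def by (force simp: field_simps)
  have cong: "fps_nth (formal_comp H (c K w)) m = fps_nth (formal_comp H (c K' w)) m"
    if "\<And>j. j \<le> m \<Longrightarrow> K j = K' j" for K K' w m
    by (rule formal_comp_nth_cong) (use that in \<open>auto simp: c_def\<close>)
  show ?thesis
  proof (rule ex_ex1I)
    define A where "A = rec_nat (\<lambda>_ _. 0)
      (\<lambda>n A. A(Suc n := (\<lambda>w. fps_nth (formal_comp H (c A w)) n / real (Suc n))))"
    define K where "K n = A n n" for n
    have A0: "A 0 = (\<lambda>_ _. 0)" by (simp add: A_def)
    have AS: "A (Suc n) = (A n)(Suc n := (\<lambda>w. fps_nth (formal_comp H (c (A n) w)) n / real (Suc n)))"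
      for n by (simp add: A_def)
    have AK: "A n j = K j" if "j \<le> n" for n j
      using that by (induction n) (auto simp: K_def AS le_Suc_eq)
    have "K (Suc m) w = fps_nth (formal_comp H (c K w)) m / real (Suc m)" for m w
    proof -
      have "K (Suc m) w = fps_nth (formal_comp H (c (A m) w)) m / real (Suc m)"
        by (simp add: K_def AS)
      also have "\<dots> = fps_nth (formal_comp H (c K w)) m / real (Suc m)"
        using cong[of m "A m" K w] AK by simp
      finally show ?thesis .
    qed
    then have "generating_coeffs H lam K"
      by (simp add: iff K_def A0)
    then show "\<exists>K. generating_coeffs H lam K" by blast
  next
    fix K K' assume K: "generating_coeffs H lam K" and K': "generating_coeffs H lam K'"
    have "K n = K' n" for n
    proof (induction n rule: less_induct)
      case (less n)
      show ?case
      proof (cases n)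
        case 0 then show ?thesis using K K' by (simp add: iff)
      next
        case (Suc m)
        then have "fps_nth (formal_comp H (c K w)) m = fps_nth (formal_comp H (c K' w)) m" for w
          using less by (intro cong) auto
        then show ?thesis using K K' by (auto simp: iff Suc)
      qed
    qed
    then show "K = K'" by blast
  qed
qed

lemma generating_coeffs_1:
  fixes H :: "'n::finite phase \<Rightarrow> real"
  assumes "generating_coeffs H lam K"
  shows "K 1 = H"
proof -
  have "real (Suc 0) * K (Suc 0) (u, v) = H (u, v)" for u v
    using assms[unfolded generating_coeffs_iff] by (simp only: formal_comp_def) simp
  then show ?thesis by auto
qed

definition truncated_series :: "(nat \<Rightarrow> 'n::finite phase \<Rightarrow> real) \<Rightarrow> nat \<Rightarrow> real \<Rightarrow> 'n phase \<Rightarrow> real" where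
  "truncated_series K r h w = (\<Sum>i=1..r. K i w * h ^ i)"


definition scheme_step :: "real \<Rightarrow> ('n::finite phase \<Rightarrow> real) \<Rightarrow> 'n phase \<Rightarrow> 'n phase \<Rightarrow> bool" where
  "scheme_step lam S z z' \<longleftrightarrow>
     (let p = fst z; q = snd z; p' = fst z'; q' = snd z';
          u = lam *\<^sub>R p' + (1 - lam) *\<^sub>R p; v = lam *\<^sub>R q + (1 - lam) *\<^sub>R q'
      in p' = p - grad2 S (u, v) \<and> q' = q + grad1 S (u, v))"

(* The implicit equations have in general several solutions: \<Phi> h z selects, for z in the open set U
   and step sizes 0 < h < h0, a smooth branch which tends to the identity as h tends to 0. *)
definition one_step_map ::
    "real \<Rightarrow> (real \<Rightarrow> 'n::finite phase \<Rightarrow> real) \<Rightarrow> real \<Rightarrow> 'n phase set \<Rightarrow> (real \<Rightarrow> 'n phase \<Rightarrow> 'n phase) \<Rightarrow> bool" where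
  "one_step_map lam S h0 U \<Phi> \<longleftrightarrow>
     0 < h0 \<and> open U \<and>
     (\<forall>h\<in>{0<..<h0}. smooth_on U (\<Phi> h) \<and> (\<forall>z\<in>U. scheme_step lam (S h) z (\<Phi> h z))) \<and>
     (\<forall>z\<in>U. ((\<lambda>h. \<Phi> h z) \<longlongrightarrow> z) (at_right 0))"


(* R^d x R^d as R^(2d): the index type 'n + 'n lists the p-components before the q-components. *)
definition stack :: "'n::finite phase \<Rightarrow> real ^ ('n + 'n)" where
  "stack z = (\<chi> k. case k of Inl i \<Rightarrow> fst z $ i | Inr i \<Rightarrow> snd z $ i)"

definition unstack :: "real ^ ('n + 'n) \<Rightarrow> 'n::finite phase" where
  "unstack x = ((\<chi> i. x $ Inl i), (\<chi> i. x $ Inr i))"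

lemma unstack_stack [simp]: "unstack (stack z) = z"
  by (simp add: stack_def unstack_def prod_eq_iff vec_eq_iff)

lemma stack_unstack [simp]: "stack (unstack x) = x"
  by (auto simp: stack_def unstack_def vec_eq_iff split: sum.split)

definition J_mat :: "real ^ ('n::finite + 'n) ^ ('n + 'n)" where
  "J_mat = (\<chi> k l. case (k, l) of
       (Inl i, Inr j) \<Rightarrow> (if i = j then 1 else 0)
     | (Inr i, Inl j) \<Rightarrow> (if i = j then - 1 else 0)
     | _ \<Rightarrow> 0)"

definition symplectic_at :: "('n::finite phase \<Rightarrow> 'n phase) \<Rightarrow> 'n phase \<Rightarrow> bool" where
  "symplectic_at f z \<longleftrightarrow> f differentiable (at z) \<and>
     (let M = jacobian (\<lambda>x. stack (f (unstack x))) (at (stack z))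
      in transpose M ** J_mat ** M = J_mat)"

definition symplectic_scheme :: "real \<Rightarrow> 'n::finite phase set \<Rightarrow> (real \<Rightarrow> 'n phase \<Rightarrow> 'n phase) \<Rightarrow> bool" where
  "symplectic_scheme h0 U \<Phi> \<longleftrightarrow> (\<forall>h\<in>{0<..<h0}. \<forall>z\<in>U. symplectic_at (\<Phi> h) z)"


definition hamiltonian_solution :: "('n::finite phase \<Rightarrow> real) \<Rightarrow> 'n phase \<Rightarrow> real \<Rightarrow> (real \<Rightarrow> 'n phase) \<Rightarrow> bool" where
  "hamiltonian_solution H z T x \<longleftrightarrow>
     x 0 = z \<and>
     (\<forall>t\<in>{0..<T}. (x has_vector_derivative (- grad2 H (x t), grad1 H (x t))) (at t within {0..<T}))"

definition scheme_of_order ::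
    "('n::finite phase \<Rightarrow> real) \<Rightarrow> 'n phase set \<Rightarrow> (real \<Rightarrow> 'n phase \<Rightarrow> 'n phase) \<Rightarrow> nat \<Rightarrow> bool" where
  "scheme_of_order H U \<Phi> r \<longleftrightarrow>
     (\<forall>z\<in>U. \<forall>T>0. \<forall>x. hamiltonian_solution H z T x \<longrightarrow>
        (\<lambda>h. norm (\<Phi> h z - x h)) \<in> O[at_right 0](\<lambda>h. h ^ (r + 1)))"

end

theory Submission
  imports Defs
begin

text \<open>
  Write the scheme as z' = z + J grad S(w), where w = z + B (z' - z), J (a, b) = (- b, a) and
  B (a, b) = (lam a, (1 - lam) b). Differentiating this relation expresses the tangent map of the
  scheme through the Hessian of S alone, and its symmetry is exactly what makes the tangent map
  preserve the symplectic form; the implicit equation need not be solved.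

  For the order, no solution of the Hamilton-Jacobi equation is constructed. The recursion for the
  coefficients says that the truncated series solves that equation up to a residual whose Taylor
  coefficients in t vanish below order r. Since partial derivatives commute, the same holds for the
  gradient of the residual, which is therefore O(t^r) uniformly on compact sets. Insert the exact solution
  x into the scheme: the derivative of the defect D(t) = x(t) - z - J grad S(w(t), t) is J applied
  to that gradient plus terms bounded by a multiple of |D(t)|, so that D(0) = 0 gives
  D(t) = O(t^(r+1)). The gradient of the truncated series has Lipschitz constant O(h), hence
  the numerical solution, which tends to z, differs from x(h) by at most twice the defect.
\<close>

section \<open>Smooth maps\<close>

text \<open>The direction comes first, so that \<open>dirderiv v\<close> is an operator on
  functions: it can be iterated with \<open>^^\<close> and commuted with other such
  operators.\<close>

definition dirderiv :: "'a::real_normed_vector \<Rightarrow> ('a \<Rightarrow> 'b::real_normed_vector) \<Rightarrow> 'a \<Rightarrow> 'b" where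
  "dirderiv v f x = frechet_derivative f (at x) v"

lemma dirderiv_eq: "(f has_derivative f') (at x) \<Longrightarrow> dirderiv v f x = f' v"
  by (metis dirderiv_def frechet_derivative_at)

lemma higher_differentiable_Suc:
  "higher_differentiable_on UNIV f (Suc k) \<longleftrightarrow>
     (\<forall>x. f differentiable (at x)) \<and> (\<forall>v. higher_differentiable_on UNIV (dirderiv v f) k)"
  by (simp add: dirderiv_def[abs_def])

lemma higher_differentiable_SucI:
  assumes "\<And>x. (f has_derivative f' x) (at x)"
    and "\<And>v. higher_differentiable_on UNIV (\<lambda>x. f' x v) k"
  shows "higher_differentiable_on UNIV f (Suc k)"
proof -
  have "dirderiv v f = (\<lambda>x. f' x v)" for v
    using assms(1) by (auto simp: dirderiv_eq)
  then show ?thesis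
    using assms unfolding higher_differentiable_Suc differentiable_def by auto
qed

lemma higher_differentiable_SucD:
  assumes "higher_differentiable_on UNIV f (Suc k)"
  shows "(f has_derivative (\<lambda>v. dirderiv v f x)) (at x)"
  using assms unfolding higher_differentiable_Suc dirderiv_def[abs_def]
  by (simp add: frechet_derivative_works)

text \<open>Differentiability gives continuity in the base case; the step passes to the directional
  derivatives. The product rule relies on this, since there one factor stays
  undifferentiated.\<close>

lemma higher_differentiable_pred:
  "higher_differentiable_on UNIV f (Suc k) \<Longrightarrow> higher_differentiable_on UNIV f k"
proof (induction k arbitrary: f)
  case 0
  then show ?case
    by (auto simp: continuous_on_eq_continuous_at differentiable_imp_continuous_within)
next
  case (Suc k)
  show ?case
    unfolding higher_differentiable_Suc
  proof (intro conjI allI Suc.IH)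
    show "f differentiable (at x)" "higher_differentiable_on UNIV (dirderiv v f) (Suc k)" for x v
      using Suc.prems unfolding higher_differentiable_Suc[of f "Suc k"] by blast+
  qed
qed

lemma higher_differentiable_const: "higher_differentiable_on UNIV (\<lambda>x. c) k"
  by (induction k arbitrary: c) auto

lemma higher_differentiable_linear:
  assumes "bounded_linear L"
  shows "higher_differentiable_on UNIV f k \<Longrightarrow> higher_differentiable_on UNIV (\<lambda>x. L (f x)) k"
proof (induction k arbitrary: f)
  case 0
  then show ?case
    using assms by (simp add: bounded_linear.continuous_on)
next
  case (Suc k)
  show ?case
  proof (rule higher_differentiable_SucI)
    show "((\<lambda>x. L (f x)) has_derivative (\<lambda>v. L (dirderiv v f x))) (at x)" for x
      by (rule bounded_linear.has_derivative[OF assms higher_differentiable_SucD[OF Suc.prems]])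
    show "higher_differentiable_on UNIV (\<lambda>x. L (dirderiv v f x)) k" for v
      using Suc by (simp only: higher_differentiable_Suc)
  qed
qed

lemma higher_differentiable_add:
  "higher_differentiable_on UNIV f k \<Longrightarrow> higher_differentiable_on UNIV g k \<Longrightarrow>
   higher_differentiable_on UNIV (\<lambda>x. f x + g x) k"
proof (induction k arbitrary: f g)
  case 0
  then show ?case by (auto intro: continuous_intros)
next
  case (Suc k)
  show ?case
  proof (rule higher_differentiable_SucI)
    show "((\<lambda>x. f x + g x) has_derivative (\<lambda>v. dirderiv v f x + dirderiv v g x)) (at x)" for x
      by (intro has_derivative_add higher_differentiable_SucD[OF Suc.prems(1)]
          higher_differentiable_SucD[OF Suc.prems(2)])
    show "higher_differentiable_on UNIV (\<lambda>x. dirderiv v f x + dirderiv v g x) k" for v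
      using Suc by (simp only: higher_differentiable_Suc)
  qed
qed

lemma higher_differentiable_sum:
  assumes "\<And>i. i \<in> I \<Longrightarrow> higher_differentiable_on UNIV (f i) k"
  shows "higher_differentiable_on UNIV (\<lambda>x. \<Sum>i\<in>I. f i x) k"
  using assms
  by (induction I rule: infinite_finite_induct)
    (auto simp: higher_differentiable_const higher_differentiable_add)

text \<open>The product rule gives two terms of the same bilinear shape, each with one factor whose
  order of differentiability is lowered by one.\<close>

lemma higher_differentiable_bilinear:
  assumes "bounded_bilinear B"
  shows "higher_differentiable_on UNIV f k \<Longrightarrow> higher_differentiable_on UNIV g k \<Longrightarrow>
    higher_differentiable_on UNIV (\<lambda>x. B (f x) (g x)) k"
proof (induction k arbitrary: f g)
  case 0
  then show ?case
    using assms by (simp add: bounded_bilinear.continuous_on)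
next
  case (Suc k)
  show ?case
  proof (rule higher_differentiable_SucI)
    show "((\<lambda>x. B (f x) (g x)) has_derivative
        (\<lambda>v. B (f x) (dirderiv v g x) + B (dirderiv v f x) (g x))) (at x)" for x
      by (intro bounded_bilinear.FDERIV[OF assms] higher_differentiable_SucD[OF Suc.prems(1)]
          higher_differentiable_SucD[OF Suc.prems(2)])
    show "higher_differentiable_on UNIV
        (\<lambda>x. B (f x) (dirderiv v g x) + B (dirderiv v f x) (g x)) k" for v
    proof (intro higher_differentiable_add Suc.IH)
      show "higher_differentiable_on UNIV f k" "higher_differentiable_on UNIV g k"
        using Suc.prems by (blast intro: higher_differentiable_pred)+
      show "higher_differentiable_on UNIV (dirderiv v f) k" "higher_differentiable_on UNIV (dirderiv v g) k"
        using Suc.prems by (simp_all only: higher_differentiable_Suc)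
    qed
  qed
qed

lemma smooth_imp_higher_differentiable: "smooth_on S f \<Longrightarrow> higher_differentiable_on S f k"
  by (simp add: smooth_on_def)

lemma smooth_has_derivative: "smooth_on UNIV f \<Longrightarrow> (f has_derivative (\<lambda>v. dirderiv v f x)) (at x)"
  by (rule higher_differentiable_SucD[OF smooth_imp_higher_differentiable])

lemma smooth_dirderiv_linear: "smooth_on UNIV f \<Longrightarrow> bounded_linear (\<lambda>v. dirderiv v f x)"
  using has_derivative_bounded_linear smooth_has_derivative by blast

text \<open>Linearity in the direction. In finite dimension this reduces a derivative along a
  varying direction to finitely many derivatives along fixed ones.\<close>

lemma smooth_dirderiv_expand:
  fixes f :: "'a::euclidean_space \<Rightarrow> 'b::real_normed_vector"
  assumes "smooth_on UNIV f"
  shows "dirderiv v f x = (\<Sum>b\<in>Basis. (v \<bullet> b) *\<^sub>R dirderiv b f x)"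
proof -
  interpret bounded_linear "\<lambda>v. dirderiv v f x"
    by (rule smooth_dirderiv_linear[OF assms])
  have "dirderiv v f x = dirderiv (\<Sum>b\<in>Basis. (v \<bullet> b) *\<^sub>R b) f x"
    by (simp add: euclidean_representation)
  then show ?thesis by (simp only: sum scaleR)
qed

named_theorems smooth_intros

lemma smooth_dirderiv [smooth_intros]: "smooth_on UNIV f \<Longrightarrow> smooth_on UNIV (dirderiv v f)"
  unfolding smooth_on_def using higher_differentiable_Suc by blast

lemma smooth_continuous: "smooth_on UNIV f \<Longrightarrow> continuous_on A f"
  by (metis continuous_on_subset higher_differentiable_on.simps(1) smooth_on_def subset_UNIV)

lemma smooth_const [smooth_intros]: "smooth_on UNIV (\<lambda>x. c)"
  by (simp add: smooth_on_def higher_differentiable_const)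

lemma smooth_linear: "bounded_linear L \<Longrightarrow> smooth_on UNIV f \<Longrightarrow> smooth_on UNIV (\<lambda>x. L (f x))"
  by (simp add: smooth_on_def higher_differentiable_linear)

lemma smooth_add [smooth_intros]:
  "smooth_on UNIV f \<Longrightarrow> smooth_on UNIV g \<Longrightarrow> smooth_on UNIV (\<lambda>x. f x + g x)"
  by (simp add: smooth_on_def higher_differentiable_add)

lemma smooth_sum [smooth_intros]:
  "(\<And>i. i \<in> I \<Longrightarrow> smooth_on UNIV (f i)) \<Longrightarrow> smooth_on UNIV (\<lambda>x. \<Sum>i\<in>I. f i x)"
  by (simp add: smooth_on_def higher_differentiable_sum)

lemma smooth_bilinear:
  "bounded_bilinear B \<Longrightarrow> smooth_on UNIV f \<Longrightarrow> smooth_on UNIV g \<Longrightarrow> smooth_on UNIV (\<lambda>x. B (f x) (g x))"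
  by (simp add: smooth_on_def higher_differentiable_bilinear)

lemmas smooth_scaleR [smooth_intros] = smooth_bilinear[OF bounded_bilinear_scaleR]
lemmas smooth_mult [smooth_intros] = smooth_bilinear[OF bounded_bilinear_mult]

lemma smooth_bounded_linear:
  assumes "bounded_linear L"
  shows "smooth_on UNIV L"
  unfolding smooth_on_def
proof
  fix k show "higher_differentiable_on UNIV L k"
  proof (cases k)
    case 0
    then show ?thesis using assms by (simp add: linear_continuous_on)
  next
    case (Suc m)
    then show ?thesis
      unfolding Suc
      by (intro higher_differentiable_SucI[OF bounded_linear_imp_has_derivative[OF assms]]
          higher_differentiable_const)
  qed
qed

lemma smooth_ident [smooth_intros]: "smooth_on UNIV (\<lambda>x. x)"
  by (rule smooth_bounded_linear) (rule bounded_linear_ident)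

lemma smooth_minus [smooth_intros]: "smooth_on UNIV f \<Longrightarrow> smooth_on UNIV (\<lambda>x. - f x)"
  by (rule smooth_linear[OF bounded_linear_minus[OF bounded_linear_ident]])

lemma smooth_diff [smooth_intros]:
  "smooth_on UNIV f \<Longrightarrow> smooth_on UNIV g \<Longrightarrow> smooth_on UNIV (\<lambda>x. f x - g x)"
  using smooth_add[OF _ smooth_minus] by auto

lemma smooth_power [smooth_intros]:
  fixes f :: "'a::real_normed_vector \<Rightarrow> real"
  shows "smooth_on UNIV f \<Longrightarrow> smooth_on UNIV (\<lambda>x. f x ^ n)"
  by (induction n) (auto intro: smooth_intros)

lemmas smooth_fst [smooth_intros] = smooth_linear[OF bounded_linear_fst]
lemmas smooth_snd [smooth_intros] = smooth_linear[OF bounded_linear_snd]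

lemma smooth_Pair [smooth_intros]:
  assumes "smooth_on UNIV f" "smooth_on UNIV g"
  shows "smooth_on UNIV (\<lambda>x. (f x, g x))"
proof -
  have L: "bounded_linear (\<lambda>x. (x, 0))" "bounded_linear (\<lambda>x. (0, x))"
    by (auto intro!: bounded_linear_intros)
  have "(\<lambda>x. (f x, g x)) = (\<lambda>x. (f x, 0) + (0, g x))"
    by auto
  then show ?thesis
    using smooth_add[OF smooth_linear[OF L(1) assms(1)] smooth_linear[OF L(2) assms(2)]] by simp
qed

text \<open>The chain rule differentiates \<open>f\<close> in the direction
  \<open>dirderiv v g x\<close>, which varies with \<open>x\<close>. Expanded in the basis it
  becomes a sum of products of smooth scalars with \<open>dirderiv b f (g x)\<close>, and the
  induction hypothesis, being general in \<open>f\<close>, covers the latter.\<close>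

lemma smooth_compose:
  fixes f :: "'b::euclidean_space \<Rightarrow> 'c::real_normed_vector"
    and g :: "'a::real_normed_vector \<Rightarrow> 'b"
  assumes "smooth_on UNIV f" "smooth_on UNIV g"
  shows "smooth_on UNIV (\<lambda>x. f (g x))"
proof -
  have "higher_differentiable_on UNIV (\<lambda>x. f (g x)) k" if "smooth_on UNIV f" for k and f :: "'b \<Rightarrow> 'c"
    using that
  proof (induction k arbitrary: f)
    case 0
    then show ?case
      using continuous_on_compose2[OF smooth_continuous[of f UNIV] smooth_continuous[OF assms(2)]] by auto
  next
    case (Suc k)
    show ?case
    proof (rule higher_differentiable_SucI)
      show "((\<lambda>x. f (g x)) has_derivative (\<lambda>v. dirderiv (dirderiv v g x) f (g x))) (at x)" for x
        using diff_chain_at[OF smooth_has_derivative[OF assms(2)] smooth_has_derivative[OF Suc.prems]]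
        by (simp add: o_def)
      have "higher_differentiable_on UNIV
          (\<lambda>x. \<Sum>b\<in>Basis. (dirderiv v g x \<bullet> b) *\<^sub>R dirderiv b f (g x)) k" for v
        by (intro higher_differentiable_sum higher_differentiable_bilinear[OF bounded_bilinear_scaleR]
            Suc.IH smooth_imp_higher_differentiable smooth_intros Suc.prems assms
            smooth_linear[OF bounded_linear_inner_left])
      then show "higher_differentiable_on UNIV (\<lambda>x. dirderiv (dirderiv v g x) f (g x)) k" for v
        by (subst smooth_dirderiv_expand[OF Suc.prems])
    qed
  qed
  then show ?thesis
    using assms by (simp add: smooth_on_def)
qed

section \<open>Mean values and the symmetry of second derivatives\<close>

lemma directional_mean_value:
  fixes f :: "'a::real_normed_vector \<Rightarrow> real"
  assumes "smooth_on UNIV f" "0 < s"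
  shows "\<exists>\<sigma>. 0 < \<sigma> \<and> \<sigma> < s \<and> f (y + s *\<^sub>R u) - f y = s * dirderiv u f (y + \<sigma> *\<^sub>R u)"
proof -
  have der: "((\<lambda>t. f (y + t *\<^sub>R u)) has_real_derivative dirderiv u f (y + t *\<^sub>R u)) (at t)" for t
  proof -
    interpret bounded_linear "\<lambda>v. dirderiv v f (y + t *\<^sub>R u)"
      by (rule smooth_dirderiv_linear[OF assms(1)])
    have "((\<lambda>t. y + t *\<^sub>R u) has_derivative (\<lambda>s. s *\<^sub>R u)) (at t)"
      by (auto intro!: derivative_eq_intros)
    from diff_chain_at[OF this smooth_has_derivative[OF assms(1)]]
    show ?thesis
      by (simp add: o_def has_field_derivative_def scaleR mult.commute[of _ "dirderiv u f _"])
  qed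
  show ?thesis
    using MVT2[OF assms(2) der] by simp
qed

text \<open>Prepares the mean value theorem for an increment of \<open>f\<close>. Smoothness of the
  translate is proved by its own induction because the domain is any normed space, while
  \<open>smooth_compose\<close> has a Euclidean one for its outer function.\<close>

lemma dirderiv_diff_shift:
  fixes f :: "'a::real_normed_vector \<Rightarrow> real"
  assumes "smooth_on UNIV f"
  shows "smooth_on UNIV (\<lambda>x. f (x + c) - f x)"
    and "dirderiv u (\<lambda>x. f (x + c) - f x) y = dirderiv u f (y + c) - dirderiv u f y"
proof -
  have shift: "((\<lambda>x. f (x + c)) has_derivative (\<lambda>v. dirderiv v f (x + c))) (at x)"
    if "smooth_on UNIV f" for x and f :: "'a \<Rightarrow> real"
  proof -
    have "((\<lambda>x. x + c) has_derivative (\<lambda>v. v)) (at x)"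
      by (auto intro!: derivative_eq_intros)
    from diff_chain_at[OF this smooth_has_derivative[OF that]] show ?thesis by (simp add: o_def)
  qed
  have "higher_differentiable_on UNIV (\<lambda>x. f (x + c)) k" if "smooth_on UNIV f" for k and f :: "'a \<Rightarrow> real"
    using that
  proof (induction k arbitrary: f)
    case 0
    then show ?case
      by (auto intro!: continuous_on_compose2[OF smooth_continuous[of f UNIV]] continuous_intros)
  next
    case (Suc k)
    then show ?case
      by (intro higher_differentiable_SucI[OF shift] Suc.IH smooth_intros) auto
  qed
  then show "smooth_on UNIV (\<lambda>x. f (x + c) - f x)"
    using assms by (intro smooth_intros) (auto simp: smooth_on_def)
  show "dirderiv u (\<lambda>x. f (x + c) - f x) y = dirderiv u f (y + c) - dirderiv u f y"
    by (intro dirderiv_eq has_derivative_diff shift smooth_has_derivative assms)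
qed

text \<open>Two mean value theorems: along \<open>u\<close> for the increment
  \<open>f (x + s *\<^sub>R v) - f x\<close> as a function of \<open>x\<close>, then along
  \<open>v\<close> for \<open>dirderiv u f\<close>.\<close>

lemma second_difference:
  fixes f :: "'a::real_normed_vector \<Rightarrow> real"
  assumes "smooth_on UNIV f" "0 < s"
  shows "\<exists>\<sigma> \<tau>. 0 < \<sigma> \<and> \<sigma> < s \<and> 0 < \<tau> \<and> \<tau> < s \<and>
    f (x + s *\<^sub>R u + s *\<^sub>R v) - f (x + s *\<^sub>R u) - f (x + s *\<^sub>R v) + f x
      = s * (s * dirderiv v (dirderiv u f) (x + \<sigma> *\<^sub>R u + \<tau> *\<^sub>R v))"
proof -
  obtain \<sigma> where \<sigma>: "0 < \<sigma>" "\<sigma> < s"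
    "(f (x + s *\<^sub>R u + s *\<^sub>R v) - f (x + s *\<^sub>R u)) - (f (x + s *\<^sub>R v) - f x)
      = s * (dirderiv u f (x + \<sigma> *\<^sub>R u + s *\<^sub>R v) - dirderiv u f (x + \<sigma> *\<^sub>R u))"
    using directional_mean_value[OF dirderiv_diff_shift(1)[OF assms(1), of "s *\<^sub>R v"] assms(2), of x u]
    unfolding dirderiv_diff_shift(2)[OF assms(1)] by blast
  obtain \<tau> where "0 < \<tau>" "\<tau> < s"
    "dirderiv u f (x + \<sigma> *\<^sub>R u + s *\<^sub>R v) - dirderiv u f (x + \<sigma> *\<^sub>R u)
      = s * dirderiv v (dirderiv u f) (x + \<sigma> *\<^sub>R u + \<tau> *\<^sub>R v)"
    using directional_mean_value[OF smooth_dirderiv[OF assms(1)] assms(2), of u "x + \<sigma> *\<^sub>R u" v] by blast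
  with \<sigma> show ?thesis by (intro exI[of _ \<sigma>] exI[of _ \<tau>]) (simp add: algebra_simps)
qed

text \<open>Schwarz's theorem: the second difference is symmetric in \<open>u\<close> and
  \<open>v\<close>, and divided by \<open>s * s\<close> it tends to either mixed derivative, so the
  two limits agree.\<close>

lemma dirderiv_commute:
  fixes f :: "'a::real_normed_vector \<Rightarrow> real"
  assumes f: "smooth_on UNIV f"
  shows "dirderiv u (dirderiv v f) x = dirderiv v (dirderiv u f) x"
proof -
  have lim: "((\<lambda>s. (f (x + s *\<^sub>R u + s *\<^sub>R v) - f (x + s *\<^sub>R u) - f (x + s *\<^sub>R v) + f x) / (s * s))
      \<longlongrightarrow> dirderiv v (dirderiv u f) x) (at_right 0)" for u v
  proof -
    define P where "P s \<sigma> \<tau> \<longleftrightarrow> 0 < \<sigma> \<and> \<sigma> < s \<and> 0 < \<tau> \<and> \<tau> < s \<and>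
      f (x + s *\<^sub>R u + s *\<^sub>R v) - f (x + s *\<^sub>R u) - f (x + s *\<^sub>R v) + f x
      = s * (s * dirderiv v (dirderiv u f) (x + \<sigma> *\<^sub>R u + \<tau> *\<^sub>R v))" for s \<sigma> \<tau>
    \<comment> \<open>The choice principle asks for a witness at every real \<open>s\<close>; the
      guard \<open>0 < s\<close> therefore sits below the existential quantifiers.\<close>
    have "\<forall>s. \<exists>\<sigma> \<tau>. 0 < s \<longrightarrow> P s \<sigma> \<tau>"
      using second_difference[OF f, of _ x u v] unfolding P_def by blast
    then obtain \<sigma> where "\<forall>s. \<exists>\<tau>. 0 < s \<longrightarrow> P s (\<sigma> s) \<tau>"
      unfolding choice_iff[of "\<lambda>s \<sigma>. \<exists>\<tau>. 0 < s \<longrightarrow> P s \<sigma> \<tau>"] by blast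
    then obtain \<tau> where st: "\<And>s. 0 < s \<Longrightarrow> P s (\<sigma> s) (\<tau> s)"
      unfolding choice_iff[of "\<lambda>s \<tau>. 0 < s \<longrightarrow> P s (\<sigma> s) \<tau>"] by blast
    have ev: "eventually (\<lambda>s::real. 0 < s) (at_right 0)" by (rule eventually_at_right_less)
    have to_0: "(g \<longlongrightarrow> 0) (at_right 0)" if "\<And>s. 0 < s \<Longrightarrow> 0 < g s \<and> g s < s" for g :: "real \<Rightarrow> real"
    proof (rule real_tendsto_sandwich)
      show "eventually (\<lambda>s. 0 \<le> g s) (at_right 0)" "eventually (\<lambda>s. g s \<le> s) (at_right 0)"
        using eventually_mono[OF ev] that by (simp_all add: less_imp_le)
      show "((\<lambda>s. s) \<longlongrightarrow> (0::real)) (at_right 0)" by (rule tendsto_ident_at)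
    qed (rule tendsto_const)
    have "(\<sigma> \<longlongrightarrow> 0) (at_right 0)" "(\<tau> \<longlongrightarrow> 0) (at_right 0)"
      using st by (auto intro!: to_0 simp: P_def)
    then have "((\<lambda>s. x + \<sigma> s *\<^sub>R u + \<tau> s *\<^sub>R v) \<longlongrightarrow> x + 0 *\<^sub>R u + 0 *\<^sub>R v) (at_right 0)"
      by (intro tendsto_intros)
    moreover have "isCont (dirderiv v (dirderiv u f)) x"
      using smooth_continuous[OF smooth_dirderiv[OF smooth_dirderiv[OF f]], of UNIV]
      by (simp add: continuous_on_eq_continuous_at)
    ultimately have "((\<lambda>s. dirderiv v (dirderiv u f) (x + \<sigma> s *\<^sub>R u + \<tau> s *\<^sub>R v))
        \<longlongrightarrow> dirderiv v (dirderiv u f) x) (at_right 0)"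
      by (intro isCont_tendsto_compose[where g = "dirderiv v (dirderiv u f)"]) simp_all
    then show ?thesis
      by (rule Lim_transform_eventually) (rule eventually_mono[OF ev], use st in \<open>simp add: P_def\<close>)
  qed
  have "((\<lambda>s. (f (x + s *\<^sub>R u + s *\<^sub>R v) - f (x + s *\<^sub>R u) - f (x + s *\<^sub>R v) + f x) / (s * s))
      \<longlongrightarrow> dirderiv u (dirderiv v f) x) (at_right 0)"
    using lim[of v u] by (simp add: algebra_simps)
  then show ?thesis
    using lim[of u v] tendsto_unique[OF trivial_limit_at_right_real] by blast
qed

section \<open>Uniform bounds on compact sets\<close>

lemma smooth_bounded_on_compact:
  assumes "smooth_on UNIV f" "compact X"
  shows "\<exists>C>0. \<forall>x\<in>X. norm (f x) \<le> C"
proof -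
  have "bounded (f ` X)"
    using compact_continuous_image[OF smooth_continuous[OF assms(1)] assms(2)] compact_imp_bounded by blast
  then show ?thesis unfolding bounded_pos by auto
qed

text \<open>Each of the finitely many basis directions has its own bound on \<open>X\<close>; their
  sum serves all directions, since the coordinates of \<open>v\<close> are at most
  \<open>norm v\<close>.\<close>

lemma smooth_dirderiv_bounded_on_compact:
  fixes f :: "'a::euclidean_space \<Rightarrow> 'b::real_normed_vector"
  assumes f: "smooth_on UNIV f" and X: "compact X"
  shows "\<exists>C>0. \<forall>x\<in>X. \<forall>v. norm (dirderiv v f x) \<le> C * norm v"
proof -
  have "\<exists>C. \<forall>b. C b > 0 \<and> (\<forall>x\<in>X. norm (dirderiv b f x) \<le> C b)"
    by (rule choice, rule allI, rule smooth_bounded_on_compact[OF smooth_dirderiv[OF f] X])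
  then obtain C where C: "\<And>b. C b > 0" "\<And>b x. x \<in> X \<Longrightarrow> norm (dirderiv b f x) \<le> C b"
    by blast
  have "norm (dirderiv v f x) \<le> (\<Sum>b\<in>Basis. C b) * norm v" if "x \<in> X" for x v
  proof -
    have "norm (dirderiv v f x) = norm (\<Sum>b\<in>Basis. (v \<bullet> b) *\<^sub>R dirderiv b f x)"
      by (rule arg_cong[OF smooth_dirderiv_expand[OF f]])
    also have "\<dots> \<le> (\<Sum>b\<in>Basis. norm v * C b)"
    proof (rule sum_norm_le)
      fix b :: 'a assume "b \<in> Basis"
      then show "norm ((v \<bullet> b) *\<^sub>R dirderiv b f x) \<le> norm v * C b"
        using C(2)[OF that, of b] by (auto intro!: mult_mono Basis_le_norm)
    qed
    finally have "norm (dirderiv v f x) \<le> norm v * (\<Sum>b\<in>Basis. C b)"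
      by (simp only: sum_distrib_left)
    then show ?thesis by (simp only: mult.commute)
  qed
  moreover have "(\<Sum>b\<in>(Basis::'a set). C b) > 0"
    by (rule sum_pos) (use C in auto)
  ultimately show ?thesis by blast
qed

lemma smooth_lipschitz_on_compact:
  fixes f :: "'a::euclidean_space \<Rightarrow> 'b::real_normed_vector"
  assumes f: "smooth_on UNIV f" and X: "compact X" "convex X"
  shows "\<exists>C>0. \<forall>x\<in>X. \<forall>y\<in>X. norm (f x - f y) \<le> C * norm (x - y)"
proof -
  obtain C where C: "C > 0" "\<And>x v. x \<in> X \<Longrightarrow> norm (dirderiv v f x) \<le> C * norm v"
    using smooth_dirderiv_bounded_on_compact[OF f X(1)] by blast
  have "norm (f x - f y) \<le> C * norm (x - y)" if "x \<in> X" "y \<in> X" for x y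
  proof (rule differentiable_bound[OF X(2) _ _ that])
    show "(f has_derivative (\<lambda>v. dirderiv v f x)) (at x within X)" for x
      by (rule has_derivative_at_withinI[OF smooth_has_derivative[OF f]])
    show "onorm (\<lambda>v. dirderiv v f x) \<le> C" if "x \<in> X" for x
      using C that by (intro onorm_le) auto
  qed
  with C(1) show ?thesis by blast
qed

text \<open>Stated within a set, because an exact solution has only a one-sided derivative at its
  initial time.\<close>

lemma chain_has_vector_derivative:
  assumes "smooth_on UNIV f" and "(w has_vector_derivative w') (at t within S)"
  shows "((\<lambda>t. f (w t)) has_vector_derivative dirderiv w' f (w t)) (at t within S)"
proof -
  have "((\<lambda>t. f (w t)) has_derivative (\<lambda>s. dirderiv (s *\<^sub>R w') f (w t))) (at t within S)"
    using has_derivative_compose[OF assms(2)[unfolded has_vector_derivative_def] smooth_has_derivative[OF assms(1)]] .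
  then show ?thesis
    unfolding has_vector_derivative_def linear_simps(5)[OF smooth_dirderiv_linear[OF assms(1)]] .
qed

section \<open>Gradients\<close>

text \<open>The full gradient on a Euclidean space, so that a phase space point counts as one
  vector; \<open>gradient_phase\<close> relates it to \<open>grad1\<close> and
  \<open>grad2\<close>.\<close>

definition gradient :: "('a::euclidean_space \<Rightarrow> real) \<Rightarrow> 'a \<Rightarrow> 'a" where
  "gradient F x = (\<Sum>b\<in>Basis. dirderiv b F x *\<^sub>R b)"

lemma gradient_inner: "smooth_on UNIV F \<Longrightarrow> gradient F x \<bullet> v = dirderiv v F x"
  by (subst smooth_dirderiv_expand[of F v])
    (simp_all add: gradient_def inner_sum_left inner_commute[of v] mult.commute)

lemma smooth_gradient [smooth_intros]: "smooth_on UNIV F \<Longrightarrow> smooth_on UNIV (gradient F)"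
  unfolding gradient_def[abs_def] by (intro smooth_intros)

lemma has_derivative_gradient:
  "smooth_on UNIV F \<Longrightarrow> (F has_derivative (\<lambda>v. gradient F x \<bullet> v)) (at x)"
  using smooth_has_derivative[of F x] by (simp add: gradient_inner)

text \<open>Here \<open>dirderiv v (gradient F) x\<close> is the Hessian applied to
  \<open>v\<close>; its pairing with \<open>w\<close> is a mixed second derivative, and these
  commute.\<close>

lemma hessian_symmetric:
  assumes "smooth_on UNIV F"
  shows "dirderiv v (gradient F) x \<bullet> w = dirderiv w (gradient F) x \<bullet> v"
proof -
  have "dirderiv v (dirderiv w F) x = dirderiv v (gradient F) x \<bullet> w" for v w
  proof -
    have "dirderiv w F = (\<lambda>x. gradient F x \<bullet> w)"
      using assms by (simp add: gradient_inner fun_eq_iff)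
    then show ?thesis
      using dirderiv_eq[OF has_derivative_inner_left[OF smooth_has_derivative[OF smooth_gradient[OF assms]]]]
      by simp
  qed
  from this[of w v] this[of v w] show ?thesis
    using dirderiv_commute[OF assms, of v w x] by simp
qed

lemma gradient_sum_scaled:
  assumes "\<And>i. i \<in> I \<Longrightarrow> smooth_on UNIV (f i)"
  shows "gradient (\<lambda>x. \<Sum>i\<in>I. f i x * a i) x = (\<Sum>i\<in>I. a i *\<^sub>R gradient (f i) x)"
proof -
  have "((\<lambda>x. \<Sum>i\<in>I. f i x * a i) has_derivative (\<lambda>v. \<Sum>i\<in>I. (gradient (f i) x \<bullet> v) * a i)) (at x)"
    by (intro has_derivative_sum has_derivative_mult_left has_derivative_gradient assms)
  then have "dirderiv v (\<lambda>x. \<Sum>i\<in>I. f i x * a i) x = (\<Sum>i\<in>I. a i *\<^sub>R gradient (f i) x) \<bullet> v" for v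
    by (subst dirderiv_eq, assumption) (simp add: inner_sum_left mult.commute)
  moreover have "smooth_on UNIV (\<lambda>x. \<Sum>i\<in>I. f i x * a i)"
    by (intro smooth_intros assms)
  ultimately have "gradient (\<lambda>x. \<Sum>i\<in>I. f i x * a i) x \<bullet> v = (\<Sum>i\<in>I. a i *\<^sub>R gradient (f i) x) \<bullet> v" for v
    by (simp only: gradient_inner)
  then show ?thesis using vector_eq_rdot by blast
qed

text \<open>The partial gradients collect the derivatives in the directions \<open>(v, 0)\<close>
  and \<open>(0, v)\<close>, because freezing one argument is composition with an affine
  embedding.\<close>

lemma gradient_phase:
  fixes F :: "'n::finite phase \<Rightarrow> real"
  assumes "smooth_on UNIV F"
  shows "gradient F w = (grad1 F w, grad2 F w)"
proof (rule prod_eqI)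
  have "((\<lambda>x. F (x, snd w)) has_derivative (\<lambda>v. dirderiv (v, 0) F w)) (at (fst w))"
  proof -
    have "((\<lambda>x. (x, snd w)) has_derivative (\<lambda>v. (v, 0))) (at (fst w))"
      by (rule has_derivative_Pair[OF has_derivative_ident has_derivative_const])
    from diff_chain_at[OF this smooth_has_derivative[OF assms]] show ?thesis by (simp add: o_def)
  qed
  from frechet_derivative_at[OF this, symmetric]
  show "fst (gradient F w) = fst (grad1 F w, grad2 F w)"
    by (simp add: grad1_def grad_def vec_eq_iff gradient_inner[OF assms, symmetric] inner_prod_def inner_axis)
  have "((\<lambda>y. F (fst w, y)) has_derivative (\<lambda>v. dirderiv (0, v) F w)) (at (snd w))"
  proof -
    have "((\<lambda>y. (fst w, y)) has_derivative (\<lambda>v. (0, v))) (at (snd w))"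
      by (rule has_derivative_Pair[OF has_derivative_const has_derivative_ident])
    from diff_chain_at[OF this smooth_has_derivative[OF assms]] show ?thesis by (simp add: o_def)
  qed
  from frechet_derivative_at[OF this, symmetric]
  show "snd (gradient F w) = snd (grad1 F w, grad2 F w)"
    by (simp add: grad2_def grad_def vec_eq_iff gradient_inner[OF assms, symmetric] inner_prod_def inner_axis)
qed

section \<open>Taylor coefficients\<close>

lemma smooth_has_real_derivative:
  fixes g :: "real \<Rightarrow> real"
  assumes "smooth_on UNIV g"
  shows "(g has_real_derivative dirderiv 1 g t) (at t)"
proof -
  have "(\<lambda>x. dirderiv x g t) = (*) (dirderiv 1 g t)"
  proof
    fix x :: real
    show "dirderiv x g t = dirderiv 1 g t * x"
      using linear_simps(5)[OF smooth_dirderiv_linear[OF assms], of x 1 t] by simp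
  qed
  then show ?thesis
    using smooth_has_derivative[OF assms, of t] unfolding has_field_derivative_def by (simp only:)
qed

lemma smooth_deriv_iterate:
  fixes g :: "real \<Rightarrow> real"
  assumes "smooth_on UNIV g"
  shows "smooth_on UNIV ((deriv ^^ m) g)"
proof (induction m)
  case (Suc m)
  have "deriv ((deriv ^^ m) g) = dirderiv 1 ((deriv ^^ m) g)"
    by (intro ext DERIV_imp_deriv smooth_has_real_derivative Suc)
  then show ?case using smooth_dirderiv[OF Suc, of 1] by simp
qed (use assms in simp)

lemma deriv_iterate_has_derivative:
  fixes g :: "real \<Rightarrow> real"
  assumes "smooth_on UNIV g"
  shows "((deriv ^^ m) g has_real_derivative (deriv ^^ Suc m) g t) (at t)"
  using smooth_has_real_derivative[OF smooth_deriv_iterate[OF assms], of m t] DERIV_imp_deriv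
  by fastforce

text \<open>Maclaurin's formula with Lagrange remainder, whose derivative factor is bounded on the
  compact unit interval.\<close>

lemma taylor_remainder_bound:
  fixes g :: "real \<Rightarrow> real"
  assumes g: "smooth_on UNIV g"
  shows "\<exists>C. \<forall>t\<in>{0..1}. \<bar>g t - (\<Sum>m<n. (deriv ^^ m) g 0 / fact m * t ^ m)\<bar> \<le> C * t ^ n"
proof -
  obtain C where C: "\<And>t. t \<in> {0..1} \<Longrightarrow> norm ((deriv ^^ n) g t) \<le> C"
    using smooth_bounded_on_compact[OF smooth_deriv_iterate[OF g] compact_Icc[of "0::real" 1]] by blast
  have "\<bar>g t - (\<Sum>m<n. (deriv ^^ m) g 0 / fact m * t ^ m)\<bar> \<le> C / fact n * t ^ n" if "t \<in> {0..1}" for t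
  proof -
    \<comment> \<open>The degenerate cases are separate since the formula is applied for positive
      \<open>t\<close> and \<open>n\<close>. The bound \<open>0 \<le> s\<close> keeps the
      intermediate point in the interval where \<open>C\<close> is valid.\<close>
    have "\<exists>s. \<bar>s\<bar> \<le> \<bar>t\<bar> \<and> g t = (\<Sum>m<n. (deriv ^^ m) g 0 / fact m * t ^ m) + (deriv ^^ n) g s / fact n * t ^ n \<and> 0 \<le> s"
    proof (cases "n = 0 \<or> t = 0")
      case True
      then show ?thesis
      proof
        assume "n = 0" then show ?thesis using that by (intro exI[of _ t]) auto
      next
        assume "t = 0" then show ?thesis
          by (cases n) (auto simp: lessThan_Suc_eq_insert_0 sum.reindex)
      qed
    next
      case False
      then have "0 < t" "0 < n" using that by auto
      from Maclaurin[OF this, of "\<lambda>m. (deriv ^^ m) g" g]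
      obtain s where "0 < s" "s < t"
        "g t = (\<Sum>m<n. (deriv ^^ m) g 0 / fact m * t ^ m) + (deriv ^^ n) g s / fact n * t ^ n"
        using deriv_iterate_has_derivative[OF g] by auto
      then show ?thesis by (intro exI[of _ s]) auto
    qed
    then obtain s where "0 \<le> s" "\<bar>s\<bar> \<le> \<bar>t\<bar>"
      and e: "g t = (\<Sum>m<n. (deriv ^^ m) g 0 / fact m * t ^ m) + (deriv ^^ n) g s / fact n * t ^ n"
      by blast
    then have "\<bar>(deriv ^^ n) g s\<bar> \<le> C" using C[of s] that by auto
    then have "\<bar>(deriv ^^ n) g s\<bar> / fact n * t ^ n \<le> C / fact n * t ^ n"
      using that by (intro mult_right_mono divide_right_mono) auto
    then show ?thesis using that by (simp add: e abs_mult)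
  qed
  then show ?thesis by blast
qed

text \<open>Letting \<open>t\<close> tend to 0 kills the constant coefficient; one factor
  \<open>t\<close> then cancels, and the shifted polynomial satisfies the same hypothesis one order
  lower. Cancelling is possible because the hypothesis speaks of positive \<open>t\<close>.\<close>

lemma polynomial_coeffs_zero:
  fixes a :: "nat \<Rightarrow> real"
  assumes "\<And>t. t \<in> {0<..1} \<Longrightarrow> \<bar>\<Sum>i<n. a i * t ^ i\<bar> \<le> C * t ^ n" and "i < n"
  shows "a i = 0"
  using assms
proof (induction n arbitrary: a i)
  case (Suc n)
  have ev: "eventually (\<lambda>t::real. t \<in> {0<..1}) (at_right 0)"
    by (rule eventually_at_rightI[of 0 1]) auto
  have split: "(\<Sum>i<Suc n. a i * t ^ i) = a 0 + t * (\<Sum>i<n. a (Suc i) * t ^ i)" for t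
    by (simp only: sum.lessThan_Suc_shift) (simp add: sum_distrib_left mult_ac)
  have "((\<lambda>t::real. C * t ^ Suc n) \<longlongrightarrow> C * 0 ^ Suc n) (at_right 0)"
    by (intro tendsto_intros)
  moreover have "((\<lambda>t. \<bar>\<Sum>i<Suc n. a i * t ^ i\<bar>) \<longlongrightarrow> \<bar>\<Sum>i<Suc n. a i * 0 ^ i\<bar>) (at_right 0)"
    by (intro tendsto_intros)
  ultimately have "\<bar>\<Sum>i<Suc n. a i * 0 ^ i\<bar> \<le> C * 0 ^ Suc n"
    by (rule tendsto_le[OF trivial_limit_at_right_real])
      (rule eventually_mono[OF ev Suc.prems(1)])
  then have a0: "a 0 = 0" unfolding split by simp
  have "a (Suc j) = 0" if "j < n" for j
  proof (rule Suc.IH[OF _ that, of "\<lambda>j. a (Suc j)"])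
    fix t :: real assume t: "t \<in> {0<..1}"
    from Suc.prems(1)[OF t] show "\<bar>\<Sum>i<n. a (Suc i) * t ^ i\<bar> \<le> C * t ^ n"
      unfolding split a0 using t by (simp add: abs_mult)
  qed
  with a0 Suc.prems(2) show ?case by (cases i) auto
qed simp

text \<open>The given polynomial and the Taylor polynomial both approximate \<open>g\<close> to
  order \<open>t ^ n\<close>, so their difference is covered by
  \<open>polynomial_coeffs_zero\<close>.\<close>

lemma taylor_coeff_unique:
  fixes g :: "real \<Rightarrow> real"
  assumes g: "smooth_on UNIV g"
    and bound: "\<And>t. t \<in> {0..1} \<Longrightarrow> \<bar>g t - (\<Sum>i<n. a i * t ^ i)\<bar> \<le> C * t ^ n"
    and m: "m < n"
  shows "(deriv ^^ m) g 0 / fact m = a m"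
proof -
  obtain C' where C': "\<And>t. t \<in> {0..1} \<Longrightarrow> \<bar>g t - (\<Sum>m<n. (deriv ^^ m) g 0 / fact m * t ^ m)\<bar> \<le> C' * t ^ n"
    using taylor_remainder_bound[OF g, of n] by blast
  have "\<bar>\<Sum>i<n. (a i - (deriv ^^ i) g 0 / fact i) * t ^ i\<bar> \<le> (C + C') * t ^ n" if "t \<in> {0<..1}" for t
  proof -
    have "(\<Sum>i<n. (a i - (deriv ^^ i) g 0 / fact i) * t ^ i) =
       (\<Sum>i<n. a i * t ^ i) - (\<Sum>m<n. (deriv ^^ m) g 0 / fact m * t ^ m)"
      by (simp add: left_diff_distrib sum_subtractf)
    moreover have "t \<in> {0..1}" using that by simp
    ultimately show ?thesis
      using bound[of t] C'[of t] unfolding distrib_right by linarith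
  qed
  from polynomial_coeffs_zero[OF this m] show ?thesis by linarith
qed

text \<open>Both curves stay in one ball on which \<open>F\<close> is Lipschitz, so the two
  compositions differ by a multiple of \<open>t ^ Suc m\<close>, and uniqueness of Taylor
  coefficients applies up to index \<open>m\<close>.\<close>

lemma deriv_iterate_compose_cong:
  fixes F :: "'a::euclidean_space \<Rightarrow> real"
  assumes F: "smooth_on UNIV F" and \<gamma>: "smooth_on UNIV \<gamma>" and \<delta>: "smooth_on UNIV \<delta>"
    and close: "\<And>t. t \<in> {0..1} \<Longrightarrow> norm (\<gamma> t - \<delta> t) \<le> C * t ^ Suc m"
  shows "(deriv ^^ m) (\<lambda>t. F (\<gamma> t)) 0 = (deriv ^^ m) (\<lambda>t. F (\<delta> t)) 0"
proof -
  obtain b1 where "\<And>t. t \<in> {0..1} \<Longrightarrow> norm (\<gamma> t) \<le> b1"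
    using smooth_bounded_on_compact[OF \<gamma> compact_Icc[of "0::real" 1]] by blast
  moreover obtain b2 where "\<And>t. t \<in> {0..1} \<Longrightarrow> norm (\<delta> t) \<le> b2"
    using smooth_bounded_on_compact[OF \<delta> compact_Icc[of "0::real" 1]] by blast
  ultimately have ball: "\<gamma> t \<in> cball 0 (max b1 b2)" "\<delta> t \<in> cball 0 (max b1 b2)" if "t \<in> {0..1}" for t
    using that by (auto simp: le_max_iff_disj)
  obtain L where L: "L > 0"
    "\<And>x y. x \<in> cball 0 (max b1 b2) \<Longrightarrow> y \<in> cball 0 (max b1 b2) \<Longrightarrow> norm (F x - F y) \<le> L * norm (x - y)"
    using smooth_lipschitz_on_compact[OF F compact_cball convex_cball, of 0 "max b1 b2"] by blast
  have sm: "smooth_on UNIV (\<lambda>t. F (\<gamma> t))" "smooth_on UNIV (\<lambda>t. F (\<delta> t))"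
    by (intro smooth_compose[OF F] \<gamma> \<delta>)+
  obtain C' where C': "\<And>t. t \<in> {0..1} \<Longrightarrow>
      \<bar>F (\<delta> t) - (\<Sum>i<Suc m. (deriv ^^ i) (\<lambda>t. F (\<delta> t)) 0 / fact i * t ^ i)\<bar> \<le> C' * t ^ Suc m"
    using taylor_remainder_bound[OF sm(2), of "Suc m"] by blast
  have "(deriv ^^ m) (\<lambda>t. F (\<gamma> t)) 0 / fact m = (deriv ^^ m) (\<lambda>t. F (\<delta> t)) 0 / fact m"
  proof (rule taylor_coeff_unique[OF sm(1) _ lessI])
    fix t :: real assume t: "t \<in> {0..1}"
    have "\<bar>F (\<gamma> t) - F (\<delta> t)\<bar> \<le> L * norm (\<gamma> t - \<delta> t)"
      using L(2) ball[OF t] by simp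
    also have "\<dots> \<le> L * (C * t ^ Suc m)"
      using close[OF t] L(1) by (intro mult_left_mono) auto
    finally have "\<bar>F (\<gamma> t) - F (\<delta> t)\<bar> \<le> L * C * t ^ Suc m"
      by (simp only: mult.assoc)
    then show "\<bar>F (\<gamma> t) - (\<Sum>i<Suc m. (deriv ^^ i) (\<lambda>t. F (\<delta> t)) 0 / fact i * t ^ i)\<bar>
        \<le> (L * C + C') * t ^ Suc m"
      using C'[OF t] unfolding distrib_right by linarith
  qed
  then show ?thesis unfolding divide_cancel_right using fact_nonzero by blast
qed

section \<open>Taylor coefficients in time of functions of a point and a time\<close>

lemma smooth_second_variable:
  fixes F :: "'a::euclidean_space \<times> real \<Rightarrow> 'b::real_normed_vector"
  assumes "smooth_on UNIV F"
  shows "smooth_on UNIV (\<lambda>t. F (w, t))"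
  by (rule smooth_compose[OF assms smooth_Pair[OF smooth_const smooth_ident]])

text \<open>Time derivatives become derivatives along \<open>(0, 1)\<close> on the product space,
  where they can be exchanged with derivatives in the point.\<close>

lemma dirderiv_second_variable:
  fixes F :: "'a::euclidean_space \<times> real \<Rightarrow> real"
  assumes "smooth_on UNIV F"
  shows "deriv (\<lambda>t. F (w, t)) t = dirderiv (0, 1) F (w, t)"
proof -
  have "((\<lambda>t. (w, t)) has_derivative (\<lambda>s. (0, s))) (at t)"
    by (rule has_derivative_Pair[OF has_derivative_const has_derivative_ident])
  from diff_chain_at[OF this smooth_has_derivative[OF assms]]
  have "((\<lambda>t. F (w, t)) has_derivative (\<lambda>s. dirderiv (0, s) F (w, t))) (at t)"
    by (simp add: o_def)
  then have "dirderiv 1 (\<lambda>t. F (w, t)) t = dirderiv (0, 1) F (w, t)"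
    by (rule dirderiv_eq)
  then show ?thesis
    using DERIV_imp_deriv[OF smooth_has_real_derivative[OF smooth_second_variable[OF assms, of w]], of t]
    by simp
qed

lemma smooth_dirderiv_iterate:
  "smooth_on UNIV F \<Longrightarrow> smooth_on UNIV ((dirderiv v ^^ m) F)"
  by (induction m) (simp_all add: smooth_dirderiv)

lemma deriv_iterate_second_variable:
  fixes F :: "'a::euclidean_space \<times> real \<Rightarrow> real"
  assumes "smooth_on UNIV F"
  shows "(deriv ^^ m) (\<lambda>t. F (w, t)) = (\<lambda>t. (dirderiv (0, 1) ^^ m) F (w, t))"
proof (induction m)
  case (Suc m)
  then have "(deriv ^^ Suc m) (\<lambda>t. F (w, t)) = deriv (\<lambda>t. (dirderiv (0, 1) ^^ m) F (w, t))"
    by simp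
  also have "\<dots> = (\<lambda>t. dirderiv (0, 1) ((dirderiv (0, 1) ^^ m) F) (w, t))"
    by (intro ext dirderiv_second_variable smooth_dirderiv_iterate assms)
  finally show ?case by simp
qed simp

lemma dirderiv_iterate_commute:
  fixes F :: "'a::real_normed_vector \<Rightarrow> real"
  assumes "smooth_on UNIV F"
  shows "(dirderiv v ^^ m) (dirderiv u F) = dirderiv u ((dirderiv v ^^ m) F)"
proof (induction m)
  case (Suc m)
  then have "(dirderiv v ^^ Suc m) (dirderiv u F) = dirderiv v (dirderiv u ((dirderiv v ^^ m) F))"
    by simp
  also have "\<dots> = dirderiv u (dirderiv v ((dirderiv v ^^ m) F))"
    by (intro ext dirderiv_commute smooth_dirderiv_iterate assms)
  finally show ?case by simp
qed simp

text \<open>Each step integrates the bound for the time derivative by a mean value in time.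
  Compactness enters once, in the base case on \<open>X \<times> {0..1}\<close>, so the constant is
  uniform in \<open>w\<close>.\<close>

lemma vanishing_taylor_coeffs_bound:
  fixes F :: "'a::euclidean_space \<times> real \<Rightarrow> real"
  assumes F: "smooth_on UNIV F" and X: "compact X"
    and vanish: "\<And>m w. m < r \<Longrightarrow> (dirderiv (0, 1) ^^ m) F (w, 0) = 0"
  shows "\<exists>C>0. \<forall>w\<in>X. \<forall>t\<in>{0..1}. \<bar>F (w, t)\<bar> \<le> C * t ^ r"
  using F vanish
proof (induction r arbitrary: F)
  case 0
  obtain C where C: "C > 0" "\<forall>x\<in>X \<times> {0..1}. norm (F x) \<le> C"
    using smooth_bounded_on_compact[OF 0(1) compact_Times[OF X compact_Icc[of "0::real" 1]]] by blast
  have "\<bar>F (w, t)\<bar> \<le> C * t ^ 0" if "w \<in> X" "t \<in> {0..1}" for w t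
    using bspec[OF C(2), of "(w, t)"] that by simp
  with C(1) show ?case by blast
next
  case (Suc r)
  have "(dirderiv (0, 1) ^^ m) (dirderiv (0, 1) F) (w, 0) = 0" if "m < r" for m w
    using Suc.prems(2)[of "Suc m" w] that by (simp add: funpow_swap1)
  from Suc.IH[OF smooth_dirderiv[OF Suc.prems(1)] this]
  obtain C where C: "C > 0" "\<And>w t. w \<in> X \<Longrightarrow> t \<in> {0..1} \<Longrightarrow> \<bar>dirderiv (0, 1) F (w, t)\<bar> \<le> C * t ^ r"
    by blast
  have "\<bar>F (w, t)\<bar> \<le> C * t ^ Suc r" if w: "w \<in> X" and t: "t \<in> {0..1}" for w t
  proof (cases "t = 0")
    case True
    then show ?thesis using Suc.prems(2)[of 0 w] by simp
  next
    case False
    then have "0 < t" using t by auto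
    from directional_mean_value[OF Suc.prems(1) this, of "(w, 0)" "(0, 1)"]
    have "\<exists>s. 0 < s \<and> s < t \<and> F (w, t) - F (w, 0) = t * dirderiv (0, 1) F (w, s)"
      by simp
    then obtain s where s: "0 < s" "s < t" "F (w, t) - F (w, 0) = t * dirderiv (0, 1) F (w, s)"
      by blast
    have "\<bar>dirderiv (0, 1) F (w, s)\<bar> \<le> C * s ^ r"
      using C(2)[OF w, of s] s t by auto
    also have "\<dots> \<le> C * t ^ r"
      using s C(1) by (intro mult_left_mono power_mono) auto
    finally show ?thesis
      using s Suc.prems(2)[of 0 w] \<open>0 < t\<close> by (simp add: abs_mult)
  qed
  with C(1) show ?case by blast
qed

section \<open>The Hamilton-Jacobi residual\<close>

text \<open>With this sign the Hamiltonian system is \<open>x' = symp_J (gradient H x)\<close>; in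
  matrix form the map is minus \<open>J_mat\<close>.\<close>

definition symp_J :: "'a::euclidean_space \<times> 'a \<Rightarrow> 'a \<times> 'a" where
  "symp_J x = (- snd x, fst x)"

text \<open>Chosen so that \<open>z + average lam (z' - z)\<close> is the point at which the scheme
  evaluates the gradient.\<close>

definition average :: "real \<Rightarrow> 'a::euclidean_space \<times> 'a \<Rightarrow> 'a \<times> 'a" where
  "average lam x = (lam *\<^sub>R fst x, (1 - lam) *\<^sub>R snd x)"

text \<open>Sends the gradient of S to the displacement of the argument of \<open>H\<close> in the
  Hamilton-Jacobi equation, namely \<open>(a, b)\<close> to
  \<open>(- (1 - lam) b, lam a)\<close>.\<close>

definition shift_J :: "real \<Rightarrow> 'a::euclidean_space \<times> 'a \<Rightarrow> 'a \<times> 'a" where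
  "shift_J lam x = symp_J x - average lam (symp_J x)"

lemma bounded_linear_symp_J: "bounded_linear symp_J"
  unfolding symp_J_def[abs_def]
  by (intro bounded_linear_Pair bounded_linear_minus bounded_linear_fst bounded_linear_snd)

lemma bounded_linear_average: "bounded_linear (average lam)"
  unfolding average_def[abs_def] by (intro bounded_linear_intros)

lemma bounded_linear_shift_J: "bounded_linear (shift_J lam)"
  unfolding shift_J_def[abs_def]
  by (intro bounded_linear_sub bounded_linear_symp_J
      bounded_linear_compose[OF bounded_linear_average bounded_linear_symp_J])

text \<open>With J for \<open>symp_J\<close> and B for \<open>average lam\<close>, the weights
  \<open>lam\<close> and \<open>1 - lam\<close> give J B + B J = J, so \<open>shift_J lam\<close> is
  J B. As B is symmetric and J skew, the adjoint is - B J. Both the order and the symplecticity rest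
  on this identity.\<close>

lemma shift_J_adjoint: "x \<bullet> shift_J lam y = - (average lam (symp_J x) \<bullet> y)"
  by (cases x; cases y) (simp add: shift_J_def symp_J_def average_def algebra_simps inner_commute)

lemma norm_symp_J [simp]: "norm (symp_J x) = norm x"
  by (simp add: symp_J_def norm_prod_def add.commute)

lemma norm_average_le: "norm (average lam x) \<le> (\<bar>lam\<bar> + \<bar>1 - lam\<bar>) * norm x"
proof -
  have "norm (average lam x) \<le> norm (lam *\<^sub>R fst x) + norm ((1 - lam) *\<^sub>R snd x)"
    unfolding average_def by (rule norm_Pair_le)
  also have "\<dots> \<le> \<bar>lam\<bar> * norm x + \<bar>1 - lam\<bar> * norm x"
    unfolding norm_scaleR using norm_fst_le[of "fst x" "snd x"] norm_snd_le[of "snd x" "fst x"]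
    by (intro add_mono mult_left_mono) auto
  finally show ?thesis by (simp add: distrib_right)
qed

section \<open>A Gronwall-type estimate and short-time confinement to a ball\<close>

text \<open>In place of an exponential bound, the interval is made so short that half of the maximum
  of \<open>norm (D t)\<close> absorbs the linear term.\<close>

lemma gronwall_order:
  fixes D D' :: "real \<Rightarrow> 'a::real_normed_vector"
  assumes \<delta>: "\<delta> > 0" and C: "C > 0" and D0: "D 0 = 0"
    and der: "\<And>t. t \<in> {0..\<delta>} \<Longrightarrow> (D has_vector_derivative D' t) (at t within {0..\<delta>})"
    and bound: "\<And>t. t \<in> {0..\<delta>} \<Longrightarrow> norm (D' t) \<le> C * norm (D t) + C * t ^ r"
  shows "\<exists>\<epsilon>>0. \<epsilon> \<le> \<delta> \<and> (\<forall>t\<in>{0..\<epsilon>}. norm (D t) \<le> 2 * C * t ^ Suc r)"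
proof -
  define \<epsilon> where "\<epsilon> = min \<delta> (1 / (2 * C))"
  have \<epsilon>: "\<epsilon> > 0" "\<epsilon> \<le> \<delta>" "C * \<epsilon> \<le> 1 / 2"
    using \<delta> C by (auto simp: \<epsilon>_def min_def field_simps)
  have "norm (D \<tau>) \<le> 2 * C * \<tau> ^ Suc r" if \<tau>: "\<tau> \<in> {0..\<epsilon>}" for \<tau>
  proof -
    have sub: "{0..\<tau>} \<subseteq> {0..\<delta>}" using \<tau> \<epsilon> by auto
    have "continuous_on {0..\<delta>} D"
      using der by (meson has_vector_derivative_continuous continuous_on_eq_continuous_within)
    then have "continuous_on {0..\<tau>} (\<lambda>t. norm (D t))"
      by (intro continuous_on_norm) (rule continuous_on_subset[OF _ sub])
    \<comment> \<open>The mean value inequality is applied up to a point where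
      \<open>norm (D t)\<close> is maximal on \<open>{0..\<tau>}\<close>, so that the same value
      appears on both sides.\<close>
    then obtain s where s: "s \<in> {0..\<tau>}" and max: "\<And>t. t \<in> {0..\<tau>} \<Longrightarrow> norm (D t) \<le> norm (D s)"
      using continuous_attains_sup[OF compact_Icc, of 0 \<tau> "\<lambda>t. norm (D t)"] \<tau> by auto
    define B where "B = C * norm (D s) + C * \<tau> ^ r"
    have "norm (D s - D 0) \<le> B * norm (s - 0)"
    proof (rule differentiable_bound[of "{0..\<tau>}"])
      fix t assume t: "t \<in> {0..\<tau>}"
      then show "(D has_derivative (\<lambda>h. h *\<^sub>R D' t)) (at t within {0..\<tau>})"
        using der[of t] sub has_vector_derivative_within_subset[OF _ sub]
        unfolding has_vector_derivative_def by blast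
      have "norm (D' t) \<le> C * norm (D t) + C * t ^ r"
        using bound t sub by blast
      also have "\<dots> \<le> B"
        unfolding B_def using C t by (intro add_mono mult_left_mono max power_mono) auto
      finally show "onorm (\<lambda>h. h *\<^sub>R D' t) \<le> B"
        by (intro onorm_le) (simp add: mult.commute[of B] mult_left_mono)
    qed (use s \<tau> in auto)
    also have "\<dots> \<le> B * \<tau>"
      using s C \<tau> by (intro mult_left_mono) (auto simp: B_def)
    also have "\<dots> = (C * \<tau>) * norm (D s) + C * \<tau> ^ Suc r"
      by (simp add: B_def algebra_simps)
    also have "\<dots> \<le> 1 / 2 * norm (D s) + C * \<tau> ^ Suc r"
    proof (intro add_right_mono mult_right_mono)
      have "C * \<tau> \<le> C * \<epsilon>" using \<tau> C by (intro mult_left_mono) auto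
      then show "C * \<tau> \<le> 1 / 2" using \<epsilon>(3) by linarith
    qed simp
    finally have "norm (D s) \<le> 2 * C * \<tau> ^ Suc r"
      unfolding D0 by simp
    then show ?thesis using max[of \<tau>] \<tau> by force
  qed
  then show ?thesis using \<epsilon> by blast
qed

lemma continuous_start_in_cball:
  fixes f :: "real \<Rightarrow> 'a::real_normed_vector"
  assumes "continuous_on {0..<T} f" "T > 0"
  shows "\<exists>\<delta>>0. \<forall>t\<in>{0..<T}. t < \<delta> \<longrightarrow> f t \<in> cball (f 0) 1"
proof -
  obtain \<delta> where "\<delta> > 0" "\<And>t. t \<in> {0..<T} \<Longrightarrow> dist t 0 < \<delta> \<Longrightarrow> dist (f t) (f 0) < 1"
    using assms(1)[unfolded continuous_on_iff, rule_format, of 0 1] assms(2) by auto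
  then show ?thesis
    by (intro exI[of _ \<delta>]) (force simp: dist_commute dist_real_def)
qed

section \<open>Regularity of the coefficients and the residual of the truncated series\<close>

context
  fixes H :: "'n::finite phase \<Rightarrow> real" and lam :: real and K :: "nat \<Rightarrow> 'n phase \<Rightarrow> real"
  assumes smooth_H: "smooth_on UNIV H" and gen: "generating_coeffs H lam K"
begin

text \<open>The argument of H in the Hamilton-Jacobi equation for the series truncated after t^m.\<close>

definition curve :: "nat \<Rightarrow> 'n phase \<Rightarrow> real \<Rightarrow> 'n phase" where
  "curve m w t = w + (\<Sum>i<m. t ^ Suc i *\<^sub>R shift_J lam (gradient (K (Suc i)) w))"

lemma smooth_curve:
  assumes "\<And>i. i < m \<Longrightarrow> smooth_on UNIV (K (Suc i))"
  shows "smooth_on UNIV (\<lambda>x. curve m (fst x) (snd x))"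
  unfolding curve_def
  by (intro smooth_add smooth_sum smooth_scaleR smooth_power smooth_fst smooth_snd smooth_ident
      smooth_linear[OF bounded_linear_shift_J] smooth_compose[OF smooth_gradient] assms) simp_all

text \<open>The defining recursion in terms of full gradients. Smoothness is assumed of the earlier
  coefficients alone, so that the induction proving smoothness can use the result.\<close>

lemma coeff_Suc_eq:
  assumes "\<And>i. i < m \<Longrightarrow> smooth_on UNIV (K (Suc i))"
  shows "real (Suc m) * K (Suc m) w = (deriv ^^ m) (\<lambda>t. H (curve m w t)) 0 / fact m"
proof -
  obtain u v where w: "w = (u, v)" by (cases w)
  have "(\<Sum>j\<le>m. t ^ j *\<^sub>R (if j = 0 then (u, v)
          else (- (1 - lam) *\<^sub>R grad2 (K j) (u, v), lam *\<^sub>R grad1 (K j) (u, v)))) = curve m w t" for t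
    unfolding curve_def sum.atMost_shift w
    by (intro arg_cong2[where f = "(+)"] sum.cong)
      (auto simp: gradient_phase assms shift_J_def symp_J_def average_def algebra_simps)
  then show ?thesis
    using gen unfolding generating_coeffs_iff formal_comp_def w by simp
qed

text \<open>By the recursion \<open>K (Suc m)\<close> is, up to a constant, the \<open>m\<close>-th
  time derivative at 0 of a function jointly smooth in point and time and built from earlier
  coefficients.\<close>

lemma smooth_coeff: "smooth_on UNIV (K i)"
proof (induction i rule: less_induct)
  case (less i)
  show ?case
  proof (cases i)
    case 0
    then show ?thesis using gen by (simp add: generating_coeffs_def smooth_const)
  next
    case (Suc m)
    have sm: "smooth_on UNIV (K (Suc j))" if "j < m" for j
      using less Suc that by simp
    define F where "F x = H (curve m (fst x) (snd x))" for x
    have F: "smooth_on UNIV F"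
      unfolding F_def by (rule smooth_compose[OF smooth_H smooth_curve[OF sm]])
    have "K (Suc m) = (\<lambda>w. (dirderiv (0, 1) ^^ m) F (w, 0) * (1 / (fact m * real (Suc m))))"
    proof
      fix w
      have "real (Suc m) * K (Suc m) w = (dirderiv (0, 1) ^^ m) F (w, 0) / fact m"
        using coeff_Suc_eq[OF sm] deriv_iterate_second_variable[OF F, of m w] by (simp add: F_def)
      then show "K (Suc m) w = (dirderiv (0, 1) ^^ m) F (w, 0) * (1 / (fact m * real (Suc m)))"
        by (simp add: field_simps del: of_nat_Suc)
    qed
    moreover have "smooth_on UNIV (\<lambda>w. (dirderiv (0, 1) ^^ m) F (w, 0) * (1 / (fact m * real (Suc m))))"
      by (intro smooth_mult smooth_const smooth_compose[OF smooth_dirderiv_iterate[OF F]]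
          smooth_Pair smooth_ident)
    ultimately show ?thesis using Suc by simp
  qed
qed

text \<open>The terms added to the curve have order at least \<open>t ^ Suc m\<close> and do not
  affect the \<open>m\<close>-th coefficient. All coefficients up to \<open>K r\<close> can thus be
  read off a single curve.\<close>

lemma coeff_from_longer_curve:
  assumes "m < r"
  shows "(deriv ^^ m) (\<lambda>t. H (curve r w t)) 0 / fact m = real (Suc m) * K (Suc m) w"
proof -
  define a where "a i = shift_J lam (gradient (K (Suc i)) w)" for i
  have "(deriv ^^ m) (\<lambda>t. H (curve r w t)) 0 = (deriv ^^ m) (\<lambda>t. H (curve m w t)) 0"
  proof (rule deriv_iterate_compose_cong[OF smooth_H])
    have "smooth_on UNIV (curve k w)" for k
      using smooth_second_variable[OF smooth_curve[of k, OF smooth_coeff], of w] by simp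
    then show "smooth_on UNIV (curve r w)" "smooth_on UNIV (curve m w)"
      by blast+
    fix t :: real assume t: "t \<in> {0..1}"
    have "curve r w t - curve m w t = (\<Sum>i\<in>{m..<r}. t ^ Suc i *\<^sub>R a i)"
      using sum.atLeastLessThan_concat[of 0 m r "\<lambda>i. t ^ Suc i *\<^sub>R a i"] assms
      by (simp add: curve_def a_def atLeast0LessThan algebra_simps)
    also have "norm \<dots> \<le> (\<Sum>i\<in>{m..<r}. norm (a i) * t ^ Suc m)"
    proof (rule sum_norm_le)
      fix i assume "i \<in> {m..<r}"
      then have "t ^ Suc i \<le> t ^ Suc m"
        using t by (intro power_decreasing) auto
      then show "norm (t ^ Suc i *\<^sub>R a i) \<le> norm (a i) * t ^ Suc m"
        using t by (simp add: abs_mult mult.commute mult_left_mono)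
    qed
    also have "\<dots> = (\<Sum>i\<in>{m..<r}. norm (a i)) * t ^ Suc m"
      by (simp only: sum_distrib_right)
    finally show "norm (curve r w t - curve m w t) \<le> (\<Sum>i\<in>{m..<r}. norm (a i)) * t ^ Suc m" .
  qed
  then show ?thesis
    using coeff_Suc_eq[OF smooth_coeff] by simp
qed

text \<open>The time derivative of the truncated series minus \<open>H\<close> at the shifted
  argument: the failure of the Hamilton-Jacobi equation at point \<open>fst x\<close> and time
  \<open>snd x\<close>.\<close>

definition residual :: "nat \<Rightarrow> 'n phase \<times> real \<Rightarrow> real" where
  "residual r x = (\<Sum>i<r. real (Suc i) * K (Suc i) (fst x) * snd x ^ i) - H (curve r (fst x) (snd x))"

lemma smooth_residual: "smooth_on UNIV (residual r)"
  unfolding residual_def[abs_def]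
  by (intro smooth_diff smooth_sum smooth_mult smooth_const smooth_power smooth_fst smooth_snd smooth_ident
      smooth_compose[OF smooth_coeff] smooth_compose[OF smooth_H] smooth_curve smooth_coeff)

text \<open>The polynomial part of the residual is exactly the Taylor polynomial of \<open>H\<close>
  along the curve, so the residual is a Taylor remainder of order \<open>t ^ r\<close>.\<close>

lemma residual_taylor_coeffs:
  assumes "m < r"
  shows "(dirderiv (0, 1) ^^ m) (residual r) (w, 0) = 0"
proof -
  have curve: "smooth_on UNIV (\<lambda>t. H (curve r w t))"
    using smooth_second_variable[OF smooth_compose[OF smooth_H smooth_curve[of r, OF smooth_coeff]], of w] by simp
  obtain C where C: "\<forall>t\<in>{0..1}.
     \<bar>H (curve r w t) - (\<Sum>m<r. (deriv ^^ m) (\<lambda>t. H (curve r w t)) 0 / fact m * t ^ m)\<bar> \<le> C * t ^ r"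
    using taylor_remainder_bound[OF curve] by blast
  have "(deriv ^^ m) (\<lambda>t. residual r (w, t)) 0 / fact m = 0"
  proof (rule taylor_coeff_unique[OF smooth_second_variable[OF smooth_residual] _ assms])
    fix t :: real assume t: "t \<in> {0..1}"
    have eq: "(\<Sum>m<r. (deriv ^^ m) (\<lambda>t. H (curve r w t)) 0 / fact m * t ^ m) =
        (\<Sum>i<r. real (Suc i) * K (Suc i) w * t ^ i)"
      by (intro sum.cong refl) (simp only: coeff_from_longer_curve lessThan_iff)
    have "\<bar>H (curve r w t) - (\<Sum>i<r. real (Suc i) * K (Suc i) w * t ^ i)\<bar> \<le> C * t ^ r"
      using bspec[OF C t] unfolding eq .
    then show "\<bar>residual r (w, t) - (\<Sum>i<r. 0 * t ^ i)\<bar> \<le> C * t ^ r"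
      by (simp add: residual_def abs_minus_commute)
  qed
  then show ?thesis
    using deriv_iterate_second_variable[OF smooth_residual, of m r w] by simp
qed

text \<open>The time coefficients vanish at every point \<open>w\<close>, hence so do their
  derivatives in \<open>w\<close>; commuting derivatives makes these the time coefficients of the
  differentiated residual.\<close>

lemma residual_dirderiv_bound:
  assumes "compact X"
  shows "\<exists>C>0. \<forall>w\<in>X. \<forall>t\<in>{0..1}. \<bar>dirderiv (v, 0) (residual r) (w, t)\<bar> \<le> C * t ^ r"
proof (rule vanishing_taylor_coeffs_bound[OF smooth_dirderiv[OF smooth_residual] assms])
  fix m and w :: "'n phase"
  assume m: "m < r"
  define G where "G = (dirderiv (0, 1) ^^ m) (residual r)"
  have G: "smooth_on UNIV G"
    unfolding G_def by (rule smooth_dirderiv_iterate[OF smooth_residual])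
  have "((\<lambda>w. (w, 0::real)) has_derivative (\<lambda>v. (v, 0))) (at w)"
    by (rule has_derivative_Pair[OF has_derivative_ident has_derivative_const])
  from diff_chain_at[OF this smooth_has_derivative[OF G]]
  have "((\<lambda>w. G (w, 0)) has_derivative (\<lambda>v. dirderiv (v, 0) G (w, 0))) (at w)"
    by (simp only: o_def)
  moreover have "(\<lambda>w. G (w, 0)) = (\<lambda>_. 0)"
    using residual_taylor_coeffs[OF m] by (simp add: G_def)
  ultimately have "(\<lambda>v. dirderiv (v, 0) G (w, 0)) = (\<lambda>_. 0)"
    using has_derivative_unique[OF _ has_derivative_const] by simp
  then have "dirderiv (v, 0) G (w, 0) = 0"
    by (rule fun_cong)
  then show "(dirderiv (0, 1) ^^ m) (dirderiv (v, 0) (residual r)) (w, 0) = 0"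
    unfolding dirderiv_iterate_commute[OF smooth_residual] G_def .
qed

text \<open>The w-gradient of the residual; the adjoint of shift_J is minus B J, and the Hessians are symmetric.\<close>

definition residual_gradient :: "nat \<Rightarrow> 'n phase \<Rightarrow> real \<Rightarrow> 'n phase" where
  "residual_gradient r w t =
     (\<Sum>i<r. (real (Suc i) * t ^ i) *\<^sub>R gradient (K (Suc i)) w) - gradient H (curve r w t)
     + (\<Sum>i<r. t ^ Suc i *\<^sub>R
          dirderiv (average lam (symp_J (gradient H (curve r w t)))) (gradient (K (Suc i))) w)"

lemma residual_dirderiv: "dirderiv (v, 0) (residual r) (w, t) = residual_gradient r w t \<bullet> v"
proof -
  define y where "y = curve r w t"
  have "((\<lambda>w. (w, t)) has_derivative (\<lambda>v. (v, 0))) (at w)"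
    by (rule has_derivative_Pair[OF has_derivative_ident has_derivative_const])
  from diff_chain_at[OF this smooth_has_derivative[OF smooth_residual]]
  have 1: "((\<lambda>w. residual r (w, t)) has_derivative (\<lambda>v. dirderiv (v, 0) (residual r) (w, t))) (at w)"
    by (simp only: o_def)
  have "((\<lambda>w. curve r w t) has_derivative
      (\<lambda>v. v + (\<Sum>i<r. t ^ Suc i *\<^sub>R shift_J lam (dirderiv v (gradient (K (Suc i))) w)))) (at w)"
    unfolding curve_def
    by (intro has_derivative_add has_derivative_ident has_derivative_sum has_derivative_scaleR_right
        bounded_linear.has_derivative[OF bounded_linear_shift_J]
        smooth_has_derivative smooth_gradient smooth_coeff)
  from diff_chain_at[OF this has_derivative_gradient[OF smooth_H]]
  have "((\<lambda>w. H (curve r w t)) has_derivative (\<lambda>v. gradient H y \<bullet>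
      (v + (\<Sum>i<r. t ^ Suc i *\<^sub>R shift_J lam (dirderiv v (gradient (K (Suc i))) w))))) (at w)"
    unfolding y_def by (simp only: o_def)
  then have "((\<lambda>w. residual r (w, t)) has_derivative
     (\<lambda>v. (\<Sum>i<r. real (Suc i) * (gradient (K (Suc i)) w \<bullet> v) * t ^ i) - gradient H y \<bullet>
      (v + (\<Sum>i<r. t ^ Suc i *\<^sub>R shift_J lam (dirderiv v (gradient (K (Suc i))) w))))) (at w)"
    unfolding residual_def fst_conv snd_conv
    by (intro has_derivative_diff has_derivative_sum has_derivative_mult_left has_derivative_mult_right
        has_derivative_gradient smooth_coeff)
  from has_derivative_unique[OF 1 this]
  have "dirderiv (v, 0) (residual r) (w, t) =
     (\<Sum>i<r. real (Suc i) * (gradient (K (Suc i)) w \<bullet> v) * t ^ i) - gradient H y \<bullet>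
      (v + (\<Sum>i<r. t ^ Suc i *\<^sub>R shift_J lam (dirderiv v (gradient (K (Suc i))) w)))"
    by (rule fun_cong)
  \<comment> \<open>Moving \<open>shift_J\<close> to the other factor produces a minus sign that
    cancels the one in front of \<open>gradient H y\<close>.\<close>
  also have "\<dots> = (\<Sum>i<r. (real (Suc i) * t ^ i) *\<^sub>R gradient (K (Suc i)) w) \<bullet> v - gradient H y \<bullet> v
     + (\<Sum>i<r. t ^ Suc i * (average lam (symp_J (gradient H y)) \<bullet> dirderiv v (gradient (K (Suc i))) w))"
    by (simp add: inner_add_right inner_sum_left inner_sum_right shift_J_adjoint sum_negf mult_ac)
  \<comment> \<open>Symmetry of the Hessians moves \<open>v\<close> out of the derivative, so that
    the whole expression is an inner product with \<open>v\<close>.\<close>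
  also have "\<dots> = residual_gradient r w t \<bullet> v"
    unfolding residual_gradient_def y_def[symmetric] inner_add_left inner_diff_left
      inner_sum_left[of "\<lambda>i. t ^ Suc i *\<^sub>R _ i"] inner_scaleR_left
    by (simp only: inner_commute[of "average _ _"] hessian_symmetric[OF smooth_coeff, of v])
  finally show ?thesis .
qed

lemma residual_gradient_bound:
  assumes "compact X"
  shows "\<exists>C>0. \<forall>w\<in>X. \<forall>t\<in>{0..1}. norm (residual_gradient r w t) \<le> C * t ^ r"
proof -
  have "\<exists>C. \<forall>b. C b > 0 \<and> (\<forall>w\<in>X. \<forall>t\<in>{0..1}. \<bar>dirderiv (b, 0) (residual r) (w, t)\<bar> \<le> C b * t ^ r)"
    by (rule choice, rule allI, rule residual_dirderiv_bound[OF assms])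
  then obtain C where C: "\<And>b. C b > 0"
    "\<And>b w t. w \<in> X \<Longrightarrow> t \<in> {0..1} \<Longrightarrow> \<bar>dirderiv (b, 0) (residual r) (w, t)\<bar> \<le> C b * t ^ r"
    by blast
  have "norm (residual_gradient r w t) \<le> (\<Sum>b\<in>Basis. C b) * t ^ r" if "w \<in> X" "t \<in> {0..1}" for w t
  proof -
    have "norm (residual_gradient r w t) \<le> (\<Sum>b\<in>Basis. \<bar>residual_gradient r w t \<bullet> b\<bar>)"
      by (rule norm_le_l1)
    also have "\<dots> \<le> (\<Sum>b\<in>Basis. C b * t ^ r)"
      using C(2)[OF that] by (intro sum_mono) (simp only: residual_dirderiv)
    finally show ?thesis by (simp only: sum_distrib_right)
  qed
  moreover have "(\<Sum>b\<in>(Basis :: 'n phase set). C b) > 0"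
    by (rule sum_pos) (use C in auto)
  ultimately show ?thesis by blast
qed

section \<open>The defect of the exact solution\<close>

text \<open>The step size is an ordinary argument because the defect of the exact solution is
  differentiated with respect to it.\<close>

definition scheme_gradient :: "nat \<Rightarrow> real \<Rightarrow> 'n phase \<Rightarrow> 'n phase" where
  "scheme_gradient r h w = (\<Sum>i<r. h ^ Suc i *\<^sub>R gradient (K (Suc i)) w)"

lemma smooth_scheme_gradient: "smooth_on UNIV (scheme_gradient r h)"
  unfolding scheme_gradient_def[abs_def]
  by (intro smooth_sum smooth_scaleR smooth_const smooth_gradient smooth_coeff)

lemma truncated_series_eq: "truncated_series K r h = (\<lambda>w. \<Sum>i<r. K (Suc i) w * h ^ Suc i)"
  by (simp add: truncated_series_def[abs_def] sum.atLeast1_atMost_eq)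

lemma smooth_truncated_series: "smooth_on UNIV (truncated_series K r h)"
  unfolding truncated_series_eq by (intro smooth_sum smooth_mult smooth_const smooth_coeff)

lemma gradient_truncated_series: "gradient (truncated_series K r h) = scheme_gradient r h"
  unfolding truncated_series_eq scheme_gradient_def[abs_def]
  by (rule ext) (rule gradient_sum_scaled[OF smooth_coeff])

lemma scheme_step_eq:
  "scheme_step lam (truncated_series K r h) z z' \<longleftrightarrow>
     z' = z + symp_J (scheme_gradient r h (z + average lam (z' - z)))"
proof -
  have arg: "(lam *\<^sub>R fst z' + (1 - lam) *\<^sub>R fst z, lam *\<^sub>R snd z + (1 - lam) *\<^sub>R snd z')
      = z + average lam (z' - z)"
    by (simp add: average_def prod_eq_iff algebra_simps)
  show ?thesis
    unfolding scheme_step_def Let_def gradient_truncated_series[symmetric]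
      gradient_phase[OF smooth_truncated_series] arg
    by (simp add: symp_J_def prod_eq_iff)
qed

text \<open>Every term carries at least one factor \<open>h\<close>, and further powers only
  decrease it for \<open>h\<close> in the unit interval. This factor turns the implicit equation
  into a contraction for small steps.\<close>

lemma scheme_gradient_lipschitz:
  assumes "compact X" "convex X"
  shows "\<exists>C>0. \<forall>h\<in>{0..1}. \<forall>x\<in>X. \<forall>y\<in>X.
    norm (scheme_gradient r h x - scheme_gradient r h y) \<le> C * h * norm (x - y)"
proof -
  have "\<exists>L. \<forall>i. L i > 0 \<and> (\<forall>x\<in>X. \<forall>y\<in>X.
      norm (gradient (K (Suc i)) x - gradient (K (Suc i)) y) \<le> L i * norm (x - y))"
    by (rule choice, rule allI, rule smooth_lipschitz_on_compact[OF smooth_gradient[OF smooth_coeff] assms])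
  then obtain L where L: "\<And>i. L i > 0" "\<And>i x y. x \<in> X \<Longrightarrow> y \<in> X \<Longrightarrow>
      norm (gradient (K (Suc i)) x - gradient (K (Suc i)) y) \<le> L i * norm (x - y)"
    by blast
  \<comment> \<open>The summand 1 keeps the constant positive even when the sum is empty.\<close>
  have "norm (scheme_gradient r h x - scheme_gradient r h y) \<le> (1 + (\<Sum>i<r. L i)) * h * norm (x - y)"
    if h: "h \<in> {0..1}" and xy: "x \<in> X" "y \<in> X" for h x y
  proof -
    have "scheme_gradient r h x - scheme_gradient r h y =
        (\<Sum>i<r. h ^ Suc i *\<^sub>R (gradient (K (Suc i)) x - gradient (K (Suc i)) y))"
      by (simp only: scheme_gradient_def sum_subtractf scaleR_diff_right)
    also have "norm \<dots> \<le> (\<Sum>i<r. L i * (h * norm (x - y)))"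
    proof (rule sum_norm_le)
      fix i
      have "h ^ Suc i \<le> h" using h power_decreasing[of 1 "Suc i" h] by simp
      then have "h ^ Suc i * norm (gradient (K (Suc i)) x - gradient (K (Suc i)) y)
          \<le> h * (L i * norm (x - y))"
        using h L(2)[OF xy, of i] by (intro mult_mono) auto
      then show "norm (h ^ Suc i *\<^sub>R (gradient (K (Suc i)) x - gradient (K (Suc i)) y))
          \<le> L i * (h * norm (x - y))"
        using h by (simp add: mult_ac)
    qed
    also have "\<dots> = (\<Sum>i<r. L i) * (h * norm (x - y))"
      by (simp only: sum_distrib_right)
    also have "\<dots> \<le> (1 + (\<Sum>i<r. L i)) * (h * norm (x - y))"
      using h by (intro mult_right_mono) auto
    finally show ?thesis by (simp only: mult.assoc)
  qed
  moreover have "1 + (\<Sum>i<r. L i) > 0"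
    using L(1) by (simp add: add_pos_nonneg sum_nonneg less_imp_le)
  ultimately show ?thesis by blast
qed

definition defect :: "nat \<Rightarrow> 'n phase \<Rightarrow> (real \<Rightarrow> 'n phase) \<Rightarrow> real \<Rightarrow> 'n phase" where
  "defect r z x t = x t - z - symp_J (scheme_gradient r t (z + average lam (x t - z)))"

text \<open>With g the scheme gradient at the averaged point, the left side is (1 - B)(x - z) - (1 -
  B) J g, that is, 1 - B applied to the defect. Hence the argument of \<open>H\<close> is close to
  the exact solution as soon as the defect is small, which closes the differential
  inequality.\<close>

lemma minus_curve_eq:
  "x t - curve r (z + average lam (x t - z)) t = defect r z x t - average lam (defect r z x t)"
proof -
  interpret S: bounded_linear "shift_J lam :: 'n phase \<Rightarrow> _" by (rule bounded_linear_shift_J)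
  interpret B: bounded_linear "average lam :: 'n phase \<Rightarrow> _" by (rule bounded_linear_average)
  have "curve r w t = w + shift_J lam (scheme_gradient r t w)" for w
    by (simp add: curve_def scheme_gradient_def S.sum S.scaleR)
  then show ?thesis
    by (simp add: defect_def shift_J_def B.diff B.add)
qed

text \<open>The derivative of the scheme gradient along \<open>w\<close> is the gradient of the
  residual with \<open>x t\<close> in place of \<open>y\<close> in the Hessian direction, and
  without its term \<open>- gradient H y\<close>. Subtracting the residual gradient leaves only
  terms in \<open>gradient H (x t) - gradient H y\<close>.\<close>

lemma defect_has_vector_derivative:
  fixes z :: "'n phase" and r :: nat
  assumes x: "(x has_vector_derivative symp_J (gradient H (x t))) (at t within S)"
  defines "w \<equiv> \<lambda>t. z + average lam (x t - z)"
  defines "y \<equiv> curve r (w t) t"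
  shows "(defect r z x has_vector_derivative
     symp_J (gradient H (x t) - gradient H y - residual_gradient r (w t) t
       - (\<Sum>i<r. t ^ Suc i *\<^sub>R
           dirderiv (average lam (symp_J (gradient H (x t) - gradient H y))) (gradient (K (Suc i))) (w t))))
     (at t within S)"
proof -
  interpret J: bounded_linear "symp_J :: 'n phase \<Rightarrow> _" by (rule bounded_linear_symp_J)
  interpret B: bounded_linear "average lam :: 'n phase \<Rightarrow> _" by (rule bounded_linear_average)
  define w' where "w' = average lam (symp_J (gradient H (x t)))"
  have "((\<lambda>t. x t - z) has_vector_derivative symp_J (gradient H (x t)) - 0) (at t within S)"
    by (intro has_vector_derivative_diff x has_vector_derivative_const)
  then have xz: "((\<lambda>t. x t - z) has_vector_derivative symp_J (gradient H (x t))) (at t within S)"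
    by simp
  have "(w has_vector_derivative 0 + w') (at t within S)"
    unfolding w_def w'_def
    by (intro has_vector_derivative_add has_vector_derivative_const B.has_vector_derivative xz)
  then have w: "(w has_vector_derivative w') (at t within S)" by simp
  have pow: "((\<lambda>t. t ^ Suc i) has_real_derivative real (Suc i) * t ^ i) (at t within S)" for i
    using DERIV_power_Suc[OF DERIV_ident, of i t S] by simp
  have "((\<lambda>t. scheme_gradient r t (w t)) has_vector_derivative
      (\<Sum>i<r. t ^ Suc i *\<^sub>R dirderiv w' (gradient (K (Suc i))) (w t)
         + (real (Suc i) * t ^ i) *\<^sub>R gradient (K (Suc i)) (w t))) (at t within S)"
    unfolding scheme_gradient_def
    by (intro has_vector_derivative_sum has_vector_derivative_scaleR pow
        chain_has_vector_derivative[OF smooth_gradient[OF smooth_coeff] w])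
  then have "(defect r z x has_vector_derivative symp_J (gradient H (x t)) -
      symp_J (\<Sum>i<r. t ^ Suc i *\<^sub>R dirderiv w' (gradient (K (Suc i))) (w t)
         + (real (Suc i) * t ^ i) *\<^sub>R gradient (K (Suc i)) (w t))) (at t within S)"
    using has_vector_derivative_diff[OF xz J.has_vector_derivative] unfolding defect_def w_def by blast
  moreover have "symp_J (gradient H (x t)) -
      symp_J (\<Sum>i<r. t ^ Suc i *\<^sub>R dirderiv w' (gradient (K (Suc i))) (w t)
         + (real (Suc i) * t ^ i) *\<^sub>R gradient (K (Suc i)) (w t)) =
     symp_J (gradient H (x t) - gradient H y - residual_gradient r (w t) t
       - (\<Sum>i<r. t ^ Suc i *\<^sub>R
           dirderiv (average lam (symp_J (gradient H (x t) - gradient H y))) (gradient (K (Suc i))) (w t)))"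
  proof -
    have "dirderiv (average lam (symp_J (gradient H (x t) - gradient H y))) (gradient (K (Suc i))) (w t) =
       dirderiv w' (gradient (K (Suc i))) (w t)
       - dirderiv (average lam (symp_J (gradient H y))) (gradient (K (Suc i))) (w t)" for i
    proof -
      interpret G: bounded_linear "\<lambda>v. dirderiv v (gradient (K (Suc i))) (w t)"
        by (rule smooth_dirderiv_linear[OF smooth_gradient[OF smooth_coeff]])
      show ?thesis unfolding w'_def J.diff B.diff G.diff ..
    qed
    then show ?thesis
      unfolding J.diff[symmetric] residual_gradient_def y_def[symmetric]
      by (simp add: sum.distrib scaleR_diff_right sum_subtractf del: of_nat_Suc power_Suc)
        (simp only: diff_diff_eq add.commute)
  qed
  ultimately show ?thesis by simp
qed

text \<open>The differential inequality for the defect is set up on a ball containing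
  \<open>x\<close>, \<open>w\<close> and \<open>y\<close> for short times. Membership of the
  averaged point in that ball is also recorded, for the later Lipschitz comparison with the
  numerical step.\<close>

lemma defect_order:
  assumes sol: "hamiltonian_solution H z T x" and T: "T > 0"
  shows "\<exists>\<epsilon>>0. \<exists>M. \<epsilon> < T \<and> (\<forall>t\<in>{0..\<epsilon>}. z + average lam (x t - z) \<in> cball z 1 \<and>
     norm (defect r z x t) \<le> M * t ^ Suc r)"
proof -
  interpret B: bounded_linear "average lam :: 'n phase \<Rightarrow> _" by (rule bounded_linear_average)
  define w where "w t = z + average lam (x t - z)" for t
  define y where "y t = curve r (w t) t" for t
  define X where "X = cball z (1::real)"
  have X: "compact X" "convex X" by (simp_all add: X_def)
  have x0: "x 0 = z" using sol by (simp add: hamiltonian_solution_def)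
  have der: "(x has_vector_derivative symp_J (gradient H (x t))) (at t within {0..<T})"
    if "t \<in> {0..<T}" for t
    using sol that by (simp add: hamiltonian_solution_def gradient_phase[OF smooth_H] symp_J_def)
  have cx: "continuous_on {0..<T} x"
    using der by (meson continuous_on_eq_continuous_within has_vector_derivative_continuous)
  then have cw: "continuous_on {0..<T} w"
    unfolding w_def by (intro continuous_intros B.continuous_on)
  have cy: "continuous_on {0..<T} y"
    unfolding y_def
    using continuous_on_compose2[OF smooth_continuous[OF smooth_curve[OF smooth_coeff], of UNIV]
        continuous_on_Pair[OF cw continuous_on_id]] by simp
  have w0: "w 0 = z" and y0: "y 0 = z"
    by (simp_all add: w_def y_def x0 B.zero curve_def)
  obtain \<delta>1 where \<delta>1: "\<delta>1 > 0" "\<forall>t\<in>{0..<T}. t < \<delta>1 \<longrightarrow> x t \<in> X"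
    using continuous_start_in_cball[OF cx T] unfolding x0 X_def by blast
  obtain \<delta>2 where \<delta>2: "\<delta>2 > 0" "\<forall>t\<in>{0..<T}. t < \<delta>2 \<longrightarrow> w t \<in> X"
    using continuous_start_in_cball[OF cw T] unfolding w0 X_def by blast
  obtain \<delta>3 where \<delta>3: "\<delta>3 > 0" "\<forall>t\<in>{0..<T}. t < \<delta>3 \<longrightarrow> y t \<in> X"
    using continuous_start_in_cball[OF cy T] unfolding y0 X_def by blast
  \<comment> \<open>Halving makes \<delta> strictly smaller than every one of the bounds.\<close>
  define \<delta> where "\<delta> = min 1 (min T (min \<delta>1 (min \<delta>2 \<delta>3))) / 2"
  have \<delta>: "\<delta> > 0" "\<delta> < T" "\<delta> < \<delta>1" "\<delta> < \<delta>2" "\<delta> < \<delta>3" "\<delta> \<le> 1"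
    using T \<delta>1(1) \<delta>2(1) \<delta>3(1) by (auto simp: \<delta>_def min_def)
  have sub: "{0..\<delta>} \<subseteq> {0..<T}" using \<delta> by auto
  have in_X: "x t \<in> X" "w t \<in> X" "y t \<in> X" if "t \<in> {0..\<delta>}" for t
    using that \<delta> \<delta>1(2) \<delta>2(2) \<delta>3(2) by auto
  obtain L where L: "L > 0" "\<And>a b. a \<in> X \<Longrightarrow> b \<in> X \<Longrightarrow> norm (gradient H a - gradient H b) \<le> L * norm (a - b)"
    using smooth_lipschitz_on_compact[OF smooth_gradient[OF smooth_H] X] by blast
  have "\<exists>N. \<forall>i. N i > 0 \<and> (\<forall>a\<in>X. \<forall>v. norm (dirderiv v (gradient (K (Suc i))) a) \<le> N i * norm v)"
    by (rule choice, rule allI, rule smooth_dirderiv_bounded_on_compact[OF smooth_gradient[OF smooth_coeff] X(1)])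
  then obtain N where N: "\<And>i. N i > 0"
      "\<And>i a v. a \<in> X \<Longrightarrow> norm (dirderiv v (gradient (K (Suc i))) a) \<le> N i * norm v"
    by blast
  obtain C where C: "C > 0" "\<And>a t. a \<in> X \<Longrightarrow> t \<in> {0..1} \<Longrightarrow> norm (residual_gradient r a t) \<le> C * t ^ r"
    using residual_gradient_bound[OF X(1), of r] by blast
  define \<beta> where "\<beta> = \<bar>lam\<bar> + \<bar>1 - lam\<bar>"
  have \<beta>: "\<beta> \<ge> 0" "\<And>v::'n phase. norm (average lam v) \<le> \<beta> * norm v"
    unfolding \<beta>_def by (simp, rule norm_average_le)
  \<comment> \<open>The factor \<open>L * (1 + \<beta>)\<close> bounds the difference of the
    gradients of \<open>H\<close> by the defect, the next factor adds the Hessian terms bounded by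
    \<open>N\<close>, and \<open>C\<close> accounts for the residual.\<close>
  define A where "A = L * (1 + \<beta>) * (1 + (\<Sum>i<r. N i) * \<beta>) + C"
  have sumN: "(\<Sum>i<r. N i) \<ge> 0" using N(1) by (simp add: sum_nonneg less_imp_le)
  have A: "A > 0" "C \<le> A" "L * (1 + \<beta>) * (1 + (\<Sum>i<r. N i) * \<beta>) \<le> A"
    using L(1) C(1) \<beta>(1) sumN by (auto simp: A_def intro!: add_nonneg_pos mult_nonneg_nonneg)
  define D' where "D' t = symp_J (gradient H (x t) - gradient H (y t) - residual_gradient r (w t) t
       - (\<Sum>i<r. t ^ Suc i *\<^sub>R
           dirderiv (average lam (symp_J (gradient H (x t) - gradient H (y t)))) (gradient (K (Suc i))) (w t)))" for t
  have "\<exists>\<epsilon>>0. \<epsilon> \<le> \<delta> \<and> (\<forall>t\<in>{0..\<epsilon>}. norm (defect r z x t) \<le> 2 * A * t ^ Suc r)"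
  proof (rule gronwall_order[OF \<delta>(1) A(1)])
    have "scheme_gradient r 0 w = 0" for w by (simp add: scheme_gradient_def)
    then show "defect r z x 0 = 0"
      by (simp add: defect_def x0 symp_J_def zero_prod_def)
    fix t assume t: "t \<in> {0..\<delta>}"
    show "(defect r z x has_vector_derivative D' t) (at t within {0..\<delta>})"
      unfolding D'_def w_def y_def
      by (rule defect_has_vector_derivative, rule has_vector_derivative_within_subset[OF der sub])
        (use t sub in auto)
    define d where "d = gradient H (x t) - gradient H (y t)"
    have d: "norm d \<le> L * (1 + \<beta>) * norm (defect r z x t)"
    proof -
      have "norm d \<le> L * norm (x t - y t)"
        unfolding d_def using in_X[OF t] by (intro L(2))
      also have "x t - y t = defect r z x t - average lam (defect r z x t)"
        unfolding y_def w_def by (rule minus_curve_eq)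
      also have "norm \<dots> \<le> norm (defect r z x t) + \<beta> * norm (defect r z x t)"
        using norm_triangle_ineq4 \<beta>(2) by (rule order_trans[OF _ add_left_mono])
      finally show ?thesis using L(1) by (simp add: algebra_simps)
    qed
    have "norm (\<Sum>i<r. t ^ Suc i *\<^sub>R dirderiv (average lam (symp_J d)) (gradient (K (Suc i))) (w t))
        \<le> (\<Sum>i<r. N i * (\<beta> * norm d))"
    proof (rule sum_norm_le)
      fix i
      have "norm (t ^ Suc i *\<^sub>R dirderiv (average lam (symp_J d)) (gradient (K (Suc i))) (w t))
          \<le> 1 * (N i * norm (average lam (symp_J d)))"
        unfolding norm_scaleR
      proof (rule mult_mono)
        show "\<bar>t ^ Suc i\<bar> \<le> 1"
          using t \<delta> by (auto simp: abs_mult power_abs intro!: mult_le_one power_le_one)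
      qed (use N(2)[OF in_X(2)[OF t]] in auto)
      also have "\<dots> \<le> N i * (\<beta> * norm d)"
        using \<beta>(2)[of "symp_J d"] N(1)[of i] by simp
      finally show "norm (t ^ Suc i *\<^sub>R dirderiv (average lam (symp_J d)) (gradient (K (Suc i))) (w t))
          \<le> N i * (\<beta> * norm d)" .
    qed
    also have "\<dots> = (\<Sum>i<r. N i) * \<beta> * norm d"
      by (simp only: sum_distrib_right mult.assoc)
    finally have S: "norm (\<Sum>i<r. t ^ Suc i *\<^sub>R dirderiv (average lam (symp_J d)) (gradient (K (Suc i))) (w t))
        \<le> (\<Sum>i<r. N i) * \<beta> * norm d" .
    have R: "norm (residual_gradient r (w t) t) \<le> C * t ^ r"
      using C(2)[OF in_X(2)[OF t]] t \<delta> by auto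
    have tri: "norm (a - b - c) \<le> norm a + norm b + norm c" for a b c :: "'n phase"
      using norm_triangle_ineq4[of "a - b" c] norm_triangle_ineq4[of a b] by linarith
    have "norm (D' t) \<le> norm d + norm (residual_gradient r (w t) t) +
        norm (\<Sum>i<r. t ^ Suc i *\<^sub>R dirderiv (average lam (symp_J d)) (gradient (K (Suc i))) (w t))"
      unfolding D'_def d_def[symmetric] norm_symp_J by (rule tri)
    also have "\<dots> \<le> (1 + (\<Sum>i<r. N i) * \<beta>) * norm d + C * t ^ r"
      using S R by (simp add: distrib_right)
    also have "\<dots> \<le> (1 + (\<Sum>i<r. N i) * \<beta>) * (L * (1 + \<beta>) * norm (defect r z x t)) + C * t ^ r"
      using d sumN \<beta>(1) by (intro add_right_mono mult_left_mono) auto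
    also have "\<dots> = L * (1 + \<beta>) * (1 + (\<Sum>i<r. N i) * \<beta>) * norm (defect r z x t) + C * t ^ r"
      by (simp only: mult_ac)
    also have "\<dots> \<le> A * norm (defect r z x t) + A * t ^ r"
      using t A by (intro add_mono mult_right_mono) auto
    finally show "norm (D' t) \<le> A * norm (defect r z x t) + A * t ^ r" .
  qed
  then obtain \<epsilon> where \<epsilon>: "\<epsilon> > 0" "\<epsilon> \<le> \<delta>" "\<forall>t\<in>{0..\<epsilon>}. norm (defect r z x t) \<le> 2 * A * t ^ Suc r"
    by blast
  have "z + average lam (x t - z) \<in> cball z 1 \<and> norm (defect r z x t) \<le> 2 * A * t ^ Suc r"
    if "t \<in> {0..\<epsilon>}" for t
  proof
    show "z + average lam (x t - z) \<in> cball z 1"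
      using in_X(2)[of t] that \<epsilon>(2) unfolding X_def w_def by simp
    show "norm (defect r z x t) \<le> 2 * A * t ^ Suc r"
      using \<epsilon>(3) that by (rule bspec)
  qed
  moreover have "\<epsilon> < T" using \<epsilon>(2) \<delta>(2) by linarith
  ultimately show ?thesis using \<epsilon>(1) by blast
qed

section \<open>Order of the scheme\<close>

text \<open>Subtracting the defect equation of the exact solution from the scheme equation bounds
  the error by the defect plus \<open>L * h * \<beta>\<close> times the error itself, which is
  absorbed for small \<open>h\<close>. That \<Phi> tends to the identity puts the numerical averaged
  point into the ball where \<open>L\<close> is valid.\<close>

lemma one_step_map_order:
  assumes step: "one_step_map lam (truncated_series K r) h0 U \<Phi>"
  shows "scheme_of_order H U \<Phi> r"
  unfolding scheme_of_order_def
proof (intro ballI allI impI)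
  fix z :: "'n phase" and T :: real and x
  assume z: "z \<in> U" and T: "0 < T" and sol: "hamiltonian_solution H z T x"
  interpret B: bounded_linear "average lam :: 'n phase \<Rightarrow> _" by (rule bounded_linear_average)
  interpret J: bounded_linear "symp_J :: 'n phase \<Rightarrow> _" by (rule bounded_linear_symp_J)
  obtain \<epsilon> M where \<epsilon>: "\<epsilon> > 0"
    and M: "\<And>h. h \<in> {0..\<epsilon>} \<Longrightarrow> z + average lam (x h - z) \<in> cball z 1"
      "\<And>h. h \<in> {0..\<epsilon>} \<Longrightarrow> norm (defect r z x h) \<le> M * h ^ Suc r"
    using defect_order[OF sol T] by blast
  obtain L where L: "L > 0" "\<And>h a b. h \<in> {0..1} \<Longrightarrow> a \<in> cball z 1 \<Longrightarrow> b \<in> cball z 1 \<Longrightarrow>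
      norm (scheme_gradient r h a - scheme_gradient r h b) \<le> L * h * norm (a - b)"
    using scheme_gradient_lipschitz[OF compact_cball convex_cball, of z 1 r] by blast
  define \<beta> where "\<beta> = \<bar>lam\<bar> + \<bar>1 - lam\<bar>"
  \<comment> \<open>Positive because \<open>lam\<close> and \<open>1 - lam\<close> cannot both
    vanish; \<beta> occurs in a denominator below.\<close>
  have \<beta>: "\<beta> > 0" "\<And>v::'n phase. norm (average lam v) \<le> \<beta> * norm v"
    unfolding \<beta>_def by (simp, rule norm_average_le)
  have eq: "\<Phi> h z = z + symp_J (scheme_gradient r h (z + average lam (\<Phi> h z - z)))" if "h \<in> {0<..<h0}" for h
    using step z that by (simp_all add: one_step_map_def scheme_step_eq)
  have h0: "h0 > 0" and lim: "((\<lambda>h. \<Phi> h z) \<longlongrightarrow> z) (at_right 0)"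
    using step z by (simp_all add: one_step_map_def)
  have "((\<lambda>h. z + average lam (\<Phi> h z - z)) \<longlongrightarrow> z + average lam (z - z)) (at_right 0)"
    by (intro tendsto_intros B.tendsto lim)
  then have "((\<lambda>h. z + average lam (\<Phi> h z - z)) \<longlongrightarrow> z) (at_right 0)"
    by (simp add: B.zero)
  from tendstoD[OF this zero_less_one]
  have near: "\<forall>\<^sub>F h in at_right 0. z + average lam (\<Phi> h z - z) \<in> cball z 1"
    by (rule eventually_mono) (simp add: dist_commute less_imp_le)
  \<comment> \<open>The last bound makes the contraction factor \<open>h * (L * \<beta>)\<close> at
    most 1/2.\<close>
  define \<eta> where "\<eta> = min (min 1 h0) (min \<epsilon> (1 / (2 * L * \<beta>)))"
  have \<eta>: "\<eta> > 0" using h0 \<epsilon> L(1) \<beta>(1) by (simp add: \<eta>_def)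
  have small: "\<forall>\<^sub>F h in at_right 0. h \<in> {0<..<\<eta>}"
    using \<eta> by (rule eventually_at_right_real)
  show "(\<lambda>h. norm (\<Phi> h z - x h)) \<in> O[at_right 0](\<lambda>h. h ^ (r + 1))"
  proof (rule bigoI[of _ "2 * M"])
    show "\<forall>\<^sub>F h in at_right 0. norm (norm (\<Phi> h z - x h)) \<le> 2 * M * norm (h ^ (r + 1))"
      using near small
    proof eventually_elim
      case (elim h)
      then have h: "0 < h" "h < 1" "h < h0" "h \<in> {0..\<epsilon>}" "h < 1 / (2 * L * \<beta>)"
        by (auto simp: \<eta>_def)
      define e where "e = \<Phi> h z - x h"
      define a where "a = z + average lam (\<Phi> h z - z)"
      define b where "b = z + average lam (x h - z)"
      have "e = symp_J (scheme_gradient r h a - scheme_gradient r h b) - defect r z x h"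
        using eq[of h] h by (simp add: e_def a_def b_def defect_def J.diff algebra_simps)
      then have "norm e \<le> norm (scheme_gradient r h a - scheme_gradient r h b) + norm (defect r z x h)"
        using norm_triangle_ineq4[of "symp_J (scheme_gradient r h a - scheme_gradient r h b)" "defect r z x h"]
        by simp
      also have "\<dots> \<le> L * h * norm (a - b) + M * h ^ Suc r"
        using h elim(1) unfolding a_def b_def by (intro add_mono L(2) M) auto
      also have "a - b = average lam e"
        by (simp add: a_def b_def e_def B.diff)
      also have "L * h * norm (average lam e) \<le> L * h * (\<beta> * norm e)"
        using L(1) h by (intro mult_left_mono \<beta>(2)) auto
      also have "L * h * (\<beta> * norm e) = (h * (L * \<beta>)) * norm e"
        by simp
      also have "\<dots> \<le> 1 / 2 * norm e"
        using h(5) L(1) \<beta>(1) by (intro mult_right_mono) (auto simp: field_simps)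
      finally show "norm (norm (\<Phi> h z - x h)) \<le> 2 * M * norm (h ^ (r + 1))"
        using h(1) by (simp add: e_def)
    qed
  qed
qed

section \<open>Symplecticity of the tangent map\<close>

text \<open>The tangent map satisfies the linearised scheme, in which it occurs on both sides.
  Pairing the relations for \<open>a\<close> and \<open>b\<close> and using the symmetry of the
  Hessian yields invariance of the form without solving for the map.\<close>

lemma one_step_map_symplectic_form:
  assumes step: "one_step_map lam (truncated_series K r) h0 U \<Phi>"
    and h: "h \<in> {0<..<h0}" and z: "z \<in> U" and f': "(\<Phi> h has_derivative f') (at z)"
  shows "f' a \<bullet> symp_J (f' b) = a \<bullet> symp_J b"
proof -
  interpret B: bounded_linear "average lam :: 'n phase \<Rightarrow> _" by (rule bounded_linear_average)
  interpret J: bounded_linear "symp_J :: 'n phase \<Rightarrow> _" by (rule bounded_linear_symp_J)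
  define w where "w = z + average lam (\<Phi> h z - z)"
  define hess where "hess v = dirderiv v (scheme_gradient r h) w" for v
  have U: "open U" and eq: "\<And>x. x \<in> U \<Longrightarrow>
      \<Phi> h x = x + symp_J (scheme_gradient r h (x + average lam (\<Phi> h x - x)))"
    using step h by (simp_all add: one_step_map_def scheme_step_eq)
  have sym: "hess p \<bullet> q = hess q \<bullet> p" for p q
    unfolding hess_def gradient_truncated_series[symmetric]
    by (rule hessian_symmetric[OF smooth_truncated_series])
  have "((\<lambda>x. x + average lam (\<Phi> h x - x)) has_derivative (\<lambda>v. v + average lam (f' v - v))) (at z)"
    by (intro has_derivative_add has_derivative_diff has_derivative_ident B.has_derivative f')
  from has_derivative_add[OF has_derivative_ident J.has_derivative[OF
      has_derivative_compose[OF this smooth_has_derivative[OF smooth_scheme_gradient]]]]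
  have "((\<lambda>x. x + symp_J (scheme_gradient r h (x + average lam (\<Phi> h x - x)))) has_derivative
      (\<lambda>v. v + symp_J (hess (v + average lam (f' v - v))))) (at z)"
    unfolding hess_def w_def .
  \<comment> \<open>As \<open>U\<close> is open, the scheme equation holds near \<open>z\<close> and
    may be differentiated there.\<close>
  then have "(\<Phi> h has_derivative (\<lambda>v. v + symp_J (hess (v + average lam (f' v - v))))) (at z)"
    by (rule has_derivative_transform_within_open[OF _ U z]) (rule eq[symmetric])
  from has_derivative_unique[OF f' this]
  have f'_eq: "f' v = v + symp_J (hess (v + average lam (f' v - v)))" for v
    by (rule fun_cong)
  define p where "p = hess (a + average lam (f' a - a))"
  define q where "q = hess (b + average lam (f' b - b))"
  have fa: "f' a = a + symp_J p" and fb: "f' b = b + symp_J q"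
    unfolding p_def q_def by (rule f'_eq)+
  have J_J: "symp_J (symp_J v) = - v" and J_skew: "v \<bullet> symp_J u = - (symp_J v \<bullet> u)"
    for u v :: "'n phase"
    by (cases u; cases v; simp add: symp_J_def algebra_simps inner_commute)+
  have "p \<bullet> (b + average lam (symp_J q)) = q \<bullet> (a + average lam (symp_J p))"
    using sym[of "a + average lam (f' a - a)" "b + average lam (f' b - b)"]
    unfolding p_def[symmetric] q_def[symmetric] by (simp only: fa fb add_diff_cancel_left')
  \<comment> \<open>Together with the preceding symmetry relation this cancels both
    \<open>average\<close> terms; what remains,
    \<open>p \<bullet> b + p \<bullet> symp_J q = q \<bullet> a\<close>, no longer contains
    \<open>lam\<close>.\<close>
  moreover have "p \<bullet> symp_J q - p \<bullet> average lam (symp_J q) = - (average lam (symp_J p) \<bullet> q)"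
    using shift_J_adjoint[of p lam q] by (simp add: shift_J_def inner_diff_right)
  ultimately have "p \<bullet> b + p \<bullet> symp_J q = q \<bullet> a"
    by (simp add: inner_add_right inner_commute)
  moreover have "f' a \<bullet> symp_J (f' b) = a \<bullet> symp_J b - a \<bullet> q + symp_J p \<bullet> symp_J b - symp_J p \<bullet> q"
    by (simp add: fa fb J.add J_J inner_add_left inner_diff_right)
  moreover have "symp_J p \<bullet> symp_J b = p \<bullet> b"
    using J_skew[of p "symp_J b"] by (simp add: J_J)
  ultimately show ?thesis
    using J_skew[of p q] by (simp add: inner_commute)
qed

end

section \<open>Symplectic matrices\<close>

lemma linear_stack: "bounded_linear (stack :: 'n::finite phase \<Rightarrow> _)"
  unfolding linear_conv_bounded_linear[symmetric]
  by (rule linearI) (auto simp: stack_def vec_eq_iff split: sum.split)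

lemma linear_unstack: "bounded_linear (unstack :: _ \<Rightarrow> 'n::finite phase)"
  unfolding linear_conv_bounded_linear[symmetric]
  by (rule linearI) (auto simp: unstack_def vec_eq_iff)

lemma inner_stack: "stack a \<bullet> stack b = a \<bullet> b" for a b :: "'n::finite phase"
proof -
  have "stack a \<bullet> stack b = (\<Sum>k\<in>UNIV <+> UNIV. stack a $ k * stack b $ k)"
    by (simp add: inner_vec_def)
  also have "\<dots> = a \<bullet> b"
    by (simp only: sum.Plus finite) (simp add: stack_def inner_prod_def inner_vec_def)
  finally show ?thesis .
qed

text \<open>The opposite sign is harmless, since the symplecticity condition is linear in the
  form.\<close>

lemma J_mat_stack: "J_mat *v stack b = - stack (symp_J b)" for b :: "'n::finite phase"
proof -
  have "(\<Sum>l\<in>UNIV <+> UNIV. J_mat $ k $ l * stack b $ l) = - stack (symp_J b) $ k" for k :: "'n + 'n"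
    by (simp only: sum.Plus finite)
      (auto simp: J_mat_def stack_def symp_J_def if_distrib[of "\<lambda>x. x * _"] cong: if_cong split: sum.split)
  then show ?thesis
    by (simp add: vec_eq_iff matrix_vector_mult_def)
qed

text \<open>The matrix identity is tested against all pairs of vectors; each vector is a stacked
  phase point, and \<open>stack\<close> preserves inner products, so the test is the invariance of
  the form.\<close>

lemma symplectic_atI:
  fixes f :: "'n::finite phase \<Rightarrow> 'n phase"
  assumes f': "(f has_derivative f') (at z)"
    and form: "\<And>a b. f' a \<bullet> symp_J (f' b) = a \<bullet> symp_J b"
  shows "symplectic_at f z"
proof -
  define M where "M = jacobian (\<lambda>x. stack (f (unstack x))) (at (stack z))"
  have "((\<lambda>x. f (unstack x)) has_derivative (\<lambda>x. f' (unstack x))) (at (stack z))"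
    by (rule has_derivative_compose[OF bounded_linear_imp_has_derivative[OF linear_unstack]])
      (simp add: f')
  then have der: "((\<lambda>x. stack (f (unstack x))) has_derivative (\<lambda>x. stack (f' (unstack x)))) (at (stack z))"
    by (rule bounded_linear.has_derivative[OF linear_stack])
  then have "((\<lambda>x. stack (f (unstack x))) has_derivative (\<lambda>x. M *v x)) (at (stack z))"
    unfolding M_def using jacobian_works differentiableI by blast
  from has_derivative_unique[OF this der]
  have M: "M *v stack a = stack (f' a)" for a
    by (metis unstack_stack)
  have "(transpose M ** J_mat ** M) *v stack b = J_mat *v stack b" for b
  proof (rule vector_eq_ldot[THEN iffD1], rule allI)
    fix x :: "real ^ ('n + 'n)"
    obtain a where x: "x = stack a" by (metis stack_unstack)
    have "x \<bullet> ((transpose M ** J_mat ** M) *v stack b) = ((J_mat *v (M *v stack b)) v* M) \<bullet> x"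
      by (simp only: matrix_vector_mul_assoc[symmetric] transpose_matrix_vector inner_commute)
    also have "\<dots> = (M *v x) \<bullet> (J_mat *v (M *v stack b))"
      unfolding dot_lmul_matrix by (rule inner_commute)
    also have "\<dots> = x \<bullet> (J_mat *v stack b)"
      unfolding x M J_mat_stack by (simp add: inner_stack form)
    finally show "x \<bullet> ((transpose M ** J_mat ** M) *v stack b) = x \<bullet> (J_mat *v stack b)" .
  qed
  then have "(transpose M ** J_mat ** M) *v x = J_mat *v x" for x
    by (metis stack_unstack)
  then have "transpose M ** J_mat ** M = J_mat"
    by (simp add: matrix_eq)
  then show ?thesis
    using differentiableI[OF f'] by (simp add: symplectic_at_def M_def)
qed

theorem mainTheorem5:
  fixes H :: "(real ^ 'n) \<times> (real ^ 'n) \<Rightarrow> real"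
    and lam h0 :: real
    and r :: nat
    and K :: "nat \<Rightarrow> (real ^ 'n) \<times> (real ^ 'n) \<Rightarrow> real"
    and U :: "((real ^ 'n) \<times> (real ^ 'n)) set"
    and \<Phi> :: "real \<Rightarrow> (real ^ 'n) \<times> (real ^ 'n) \<Rightarrow> (real ^ 'n) \<times> (real ^ 'n)"
  assumes "smooth_on UNIV H"
    and "lam \<noteq> 1 / 2"
    and "r \<ge> 1"
    and "generating_coeffs H lam K"
    and "one_step_map lam (truncated_series K r) h0 U \<Phi>"
  shows "symplectic_scheme h0 U \<Phi> \<and> scheme_of_order H U \<Phi> r"
proof
  show "scheme_of_order H U \<Phi> r"
    by (rule one_step_map_order[OF assms(1,4,5)])
  show "symplectic_scheme h0 U \<Phi>"
    unfolding symplectic_scheme_def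
  proof (intro ballI)
    fix h z assume h: "h \<in> {0<..<h0}" and z: "z \<in> U"
    \<comment> \<open>The first level of smoothness supplies the Frechet derivative at each point of
      \<open>U\<close>.\<close>
    have "higher_differentiable_on U (\<Phi> h) (Suc 0)"
      using assms(5) h by (simp only: one_step_map_def smooth_on_def)
    then have "(\<Phi> h has_derivative frechet_derivative (\<Phi> h) (at z)) (at z)"
      using z by (simp add: frechet_derivative_works)
    then show "symplectic_at (\<Phi> h) z"
      using one_step_map_symplectic_form[OF assms(1,4,5) h z] by (intro symplectic_atI)
  qed
qed

end
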